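(* Let $(L_\bullet,c)$ be a graded lattice chain of $V$. Then $(L_\bullet,c)$ corresponds to a norm in $\mathcal{N}_{mm}$ (a maxi-minorant norm for $(h,\bar q)$) if and only if there exists a basis $(f_i)_{1\le i\le n}$ of $V$ inducing a Witt decomposition $V=V_-\oplus V_0\oplus V_+$ and $(L_\bullet,c)$ decomposes as $(L^{\pm}_\bullet,c^{\pm})\oplus(L^0_\bullet,c^0)$, such that $(L^\pm_\bullet,c^\pm)$ is a self-dual graded lattice chain of $V_-\oplus V_+$ adapted to the basis $(f_i)_{i\ne m+1}$, and $(L^0_\bullet,c^0)$ is the graded lattice chain corresponding to the norm $\alpha_0$ on $V_0$, where $\alpha_0$ is the unique norm on $V_0$ with $\alpha_0(f_{m+1})=\frac12\delta$.
   Context: $F_0/\mathbb{Q}_2$ is a finite extension, $F/F_0$ a ramified quadratic extension with conjugation $\sigma$ (also $x\mapsto\bar x$), $\omega$ the normalized valuation of $F_0$ extended to $F$. $V$ is an $F$-vector space of dimension $n=2m+1\ge3$ with a non-degenerate split hermitian form $h$ (there is a basis $(e_i)$ with $h(e_i,e_j)=\delta_{i,n+1-j}$). $\delta:=\sup\{\omega(\lambda)\mid\lambda\in F,\ \lambda+\lambda^\sigma=1\}$. Norms: a norm on a finite-dimensional $F$-vector space $V$ is a map $\alpha:V\to\mathbb{R}\cup\{+\infty\}$ with $\alpha(x+y)\ge\inf\{\alpha(x),\alpha(y)\}$, $\alpha(\lambda x)=\omega(\lambda)+\alpha(x)$, and $\alpha(x)=+\infty\Leftrightarrow x=0$. Direct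 sum: $(\alpha_1\oplus\alpha_2)(x_1+x_2)=\inf\{\alpha_1(x_1),\alpha_2(x_2)\}$. Dual norm (with respect to a non-degenerate hermitian form $h$): $\alpha^\vee(x)=\inf_{y}\{\omega(h(x,y))-\alpha(y)\}$; $\alpha$ is self-dual if $\alpha=\alpha^\vee$. Maxi-minorant norms: let $F_\sigma=\{\lambda-\lambda^\sigma\mid\lambda\in F\}$, $\bar q:V\to F/F_\sigma$, $\bar q(x)=\frac12h(x,x)+F_\sigma$, and $\bar\omega(\lambda+F_\sigma)=\sup\{\omega(\lambda+\mu-\mu^\sigma)\mid\mu\in F\}$. A norm $\alpha$ on $V$ minorizes $(h,\bar q)$ if $\alpha(x)+\alpha(y)\le\omega(h(x,y))$ and $\alpha(x)\le\frac12\bar\omega(\bar q(x))$ for all $x,y\in V$. It is maxi-minorant if it minorizes $(h,\bar q)$ and is maximal with this property. $\mathcal{N}_{mm}$ is the set of maxi-minorant norms on $V$. Graded lattice chains: a lattice chain $L_\bullet$ is a non-empty set of $\mathcal{O}_F$-lattices in $V$, totally ordered by inclusion and stable under multiplication by $F^\times$. A graded lattice chain is a pair $(L_\bullet,c)$ with $c:L_\bullet\to\mathbb{R}$ strictly decreasing with respect to inclusion and $c(\lambda L)=\omega(\lambda)+c(L)$ for $\lambda\in F^\times$. A basis $(v_i)$ is adapted to $(L_\bullet,c)$ if for each $L\in L_\bullet$ there are $x_i\in F$ with $(x_iv_i)$ an $\mathcal{O}_F$-basis of $L$. Norms and graded lattice chains correspond bijectively: $\alpha$ corresponds to the set of lattices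 $L_{\alpha,r}=\{x\mid\alpha(x)\ge r\}$, $r\in\mathbb{R}$, with $c_\alpha(L_{\alpha,r})=\inf_{x\in L_{\alpha,r}}\alpha(x)$; conversely $\alpha(x)=\sup\{c(L)\mid x\in L\in L_\bullet\}$. Direct sums and duals of graded lattice chains are those corresponding to direct sums and duals of norms; a graded lattice chain is self-dual if it equals its dual. Witt decompositions: a basis $(f_i)_{1\le i\le n}$ of $V$ induces the Witt decomposition $V_-=\operatorname{span}(f_1,\ldots,f_m)$, $V_0=\operatorname{span}(f_{m+1})$, $V_+=\operatorname{span}(f_{m+2},\ldots,f_n)$ if $V_\pm$ are maximal isotropic, $V_0$ is the orthogonal complement of $V_-\oplus V_+$, and $h(f_i,f_j)=\delta_{i,n+1-j}$. *)

theory Defs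
  imports Main "HOL-Library.Extended_Real" "HOL-Computational_Algebra.Primes"
begin

text \<open>
  Valuations and norms take values in \<^typ>\<open>ereal\<close>, with \<open>-\<infinity>\<close> excluded explicitly.  The field
  \<open>F\<close> and the space \<open>V\<close> are whole types; subfields of \<open>F\<close> and subspaces of \<open>V\<close> are sets.
\<close>

section \<open>Ramified quadratic extensions of dyadic fields\<close>

definition is_valuation :: "('f::field \<Rightarrow> ereal) \<Rightarrow> bool" where
  "is_valuation \<omega> \<longleftrightarrow>
     (\<forall>x. \<omega> x \<noteq> -\<infinity>) \<and> (\<forall>x. \<omega> x = \<infinity> \<longleftrightarrow> x = 0) \<and>
     (\<forall>x y. \<omega> (x * y) = \<omega> x + \<omega> y) \<and> (\<forall>x y. min (\<omega> x) (\<omega> y) \<le> \<omega> (x + y))"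

definition is_subfield :: "'f::field set \<Rightarrow> bool" where
  "is_subfield K \<longleftrightarrow>
     0 \<in> K \<and> 1 \<in> K \<and> (\<forall>x\<in>K. - x \<in> K \<and> inverse x \<in> K) \<and>
     (\<forall>x\<in>K. \<forall>y\<in>K. x + y \<in> K \<and> x * y \<in> K)"

definition two_adic_val :: "rat \<Rightarrow> ereal" where
  "two_adic_val q =
     (if q = 0 then \<infinity>
      else ereal (real (multiplicity 2 (fst (quotient_of q)))
                  - real (multiplicity 2 (snd (quotient_of q)))))"

text \<open>
  \<open>K\<close> is a copy of the field of 2-adic numbers, i.e.\ a completion of the rationals for the 2-adic
  valuation, and \<open>\<omega>\<close> restricts to a positive multiple of the 2-adic valuation on it.
  (The multiple is the ramification index of \<open>F\<^sub>0\<close> once \<open>\<omega>\<close> is normalized on \<open>F\<^sub>0\<close>.)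
\<close>
definition is_Q2 :: "('f::field_char_0 \<Rightarrow> ereal) \<Rightarrow> 'f set \<Rightarrow> bool" where
  "is_Q2 \<omega> K \<longleftrightarrow>
     is_subfield K \<and>
     (\<exists>c>0. \<forall>q. \<omega> (of_rat q) = ereal c * two_adic_val q) \<and>
     (\<forall>x\<in>K. \<forall>r::real. \<exists>q. ereal r \<le> \<omega> (x - of_rat q)) \<and>
     (\<forall>X::nat \<Rightarrow> 'f.
        (\<forall>i. X i \<in> K) \<and> (\<forall>r::real. \<exists>N. \<forall>i\<ge>N. \<forall>j\<ge>N. ereal r \<le> \<omega> (X i - X j)) \<longrightarrow>
        (\<exists>x\<in>K. \<forall>r::real. \<exists>N. \<forall>i\<ge>N. ereal r \<le> \<omega> (X i - x)))"

definition finite_field_extension :: "'f::field set \<Rightarrow> 'f set \<Rightarrow> bool" where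
  "finite_field_extension K E \<longleftrightarrow>
     is_subfield K \<and> is_subfield E \<and> K \<subseteq> E \<and>
     (\<exists>B. finite B \<and> B \<subseteq> E \<and>
        (\<forall>x\<in>E. \<exists>a. (\<forall>b\<in>B. a b \<in> K) \<and> x = (\<Sum>b\<in>B. a b * b)))"

text \<open>
  \<open>F\<close> is the whole type \<open>'f\<close>.  An extension of a valuation along a finite extension of a complete
  field is unique, so \<open>\<omega>\<close> is determined by the assumptions.
\<close>
locale ramified_dyadic_extension =
  fixes Q2 F\<^sub>0 :: "'f::field_char_0 set" and \<sigma> :: "'f \<Rightarrow> 'f" and \<omega> :: "'f \<Rightarrow> ereal"
  assumes valuation: "is_valuation \<omega>"
    and Q2: "is_Q2 \<omega> Q2"
    and finite_ext: "finite_field_extension Q2 F\<^sub>0"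
    and normalized: "\<omega> ` (F\<^sub>0 - {0}) = range (\<lambda>k::int. ereal (of_int k))"
    and quadratic: "\<exists>\<theta>. \<theta> \<notin> F\<^sub>0 \<and> (\<forall>x. \<exists>a\<in>F\<^sub>0. \<exists>b\<in>F\<^sub>0. x = a + b * \<theta>)"
    and ramified: "\<omega> ` (UNIV - {0}) \<noteq> \<omega> ` (F\<^sub>0 - {0})"
    and conj_add: "\<sigma> (x + y) = \<sigma> x + \<sigma> y"
    and conj_mult: "\<sigma> (x * y) = \<sigma> x * \<sigma> y"
    and conj_fixes: "a \<in> F\<^sub>0 \<Longrightarrow> \<sigma> a = a"
    and conj_nontrivial: "\<sigma> \<noteq> id"

definition ring_of_integers :: "('f::field \<Rightarrow> ereal) \<Rightarrow> 'f set" where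
  "ring_of_integers \<omega> = {x. 0 \<le> \<omega> x}"

definition delta_inv :: "('f::field \<Rightarrow> 'f) \<Rightarrow> ('f \<Rightarrow> ereal) \<Rightarrow> ereal" where
  "delta_inv \<sigma> \<omega> = Sup {\<omega> t | t. t + \<sigma> t = 1}"

section \<open>Split hermitian spaces\<close>

definition is_basis ::
  "('f::field \<Rightarrow> 'v::ab_group_add \<Rightarrow> 'v) \<Rightarrow> nat set \<Rightarrow> (nat \<Rightarrow> 'v) \<Rightarrow> 'v set \<Rightarrow> bool" where
  "is_basis s I v W \<longleftrightarrow>
     inj_on v I \<and> \<not> module.dependent s (v ` I) \<and> module.span s (v ` I) = W"

text \<open>Convention: conjugate-linear in the first and linear in the second variable.\<close>
definition hermitian_form ::
  "('f::field \<Rightarrow> 'f) \<Rightarrow> ('f \<Rightarrow> 'v::ab_group_add \<Rightarrow> 'v) \<Rightarrow> ('v \<Rightarrow> 'v \<Rightarrow> 'f) \<Rightarrow> bool" where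
  "hermitian_form \<sigma> s h \<longleftrightarrow>
     (\<forall>x y z. h x (y + z) = h x y + h x z) \<and>
     (\<forall>a x y. h x (s a y) = a * h x y) \<and>
     (\<forall>x y. h y x = \<sigma> (h x y))"

definition nondegenerate :: "('v::zero \<Rightarrow> 'v \<Rightarrow> 'f::zero) \<Rightarrow> bool" where
  "nondegenerate h \<longleftrightarrow> (\<forall>x. (\<forall>y. h x y = 0) \<longrightarrow> x = 0)"

definition antidiagonal_on :: "('v \<Rightarrow> 'v \<Rightarrow> 'f::zero_neq_one) \<Rightarrow> nat \<Rightarrow> (nat \<Rightarrow> 'v) \<Rightarrow> bool" where
  "antidiagonal_on h n e \<longleftrightarrow>
     (\<forall>i\<in>{1..n}. \<forall>j\<in>{1..n}. h (e i) (e j) = (if i = n + 1 - j then 1 else 0))"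

locale split_hermitian_space = vector_space s
  for s :: "'f::field \<Rightarrow> 'v::ab_group_add \<Rightarrow> 'v" +
  fixes \<sigma> :: "'f \<Rightarrow> 'f" and h :: "'v \<Rightarrow> 'v \<Rightarrow> 'f" and n m :: nat
  assumes odd_dim: "n = 2 * m + 1" and dim_ge: "3 \<le> n"
    and hermitian: "hermitian_form \<sigma> s h"
    and nondeg: "nondegenerate h"
    and split: "\<exists>e. is_basis s {1..n} e UNIV \<and> antidiagonal_on h n e"

section \<open>Norms on a subspace\<close>

text \<open>A norm on \<open>W\<close> is a function on all of \<open>'v\<close> of which only the values on \<open>W\<close> matter.\<close>
definition norm_on ::
  "('f::field \<Rightarrow> ereal) \<Rightarrow> ('f \<Rightarrow> 'v::ab_group_add \<Rightarrow> 'v) \<Rightarrow> 'v set \<Rightarrow> ('v \<Rightarrow> ereal) \<Rightarrow> bool" where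
  "norm_on \<omega> s W \<alpha> \<longleftrightarrow>
     (\<forall>x\<in>W. \<alpha> x \<noteq> -\<infinity>) \<and>
     (\<forall>x\<in>W. \<forall>y\<in>W. min (\<alpha> x) (\<alpha> y) \<le> \<alpha> (x + y)) \<and>
     (\<forall>a. \<forall>x\<in>W. \<alpha> (s a x) = \<omega> a + \<alpha> x) \<and>
     (\<forall>x\<in>W. \<alpha> x = \<infinity> \<longleftrightarrow> x = 0)"

text \<open>\<open>y = 0\<close> is left out of the infimum: it would contribute the undefined \<open>\<infinity> - \<infinity>\<close>.\<close>
definition dual_norm ::
  "('f::field \<Rightarrow> ereal) \<Rightarrow> ('v::zero \<Rightarrow> 'v \<Rightarrow> 'f) \<Rightarrow> 'v set \<Rightarrow> ('v \<Rightarrow> ereal) \<Rightarrow> 'v \<Rightarrow> ereal" where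
  "dual_norm \<omega> h W \<alpha> x = (INF y\<in>W - {0}. \<omega> (h x y) - \<alpha> y)"

definition F_sigma :: "('f::field \<Rightarrow> 'f) \<Rightarrow> 'f set" where
  "F_sigma \<sigma> = {t - \<sigma> t | t. True}"

text \<open>Elements of \<open>F / F\<^sub>\<sigma>\<close> are represented by the cosets themselves, as subsets of \<open>F\<close>.\<close>
definition q_bar :: "('f::field \<Rightarrow> 'f) \<Rightarrow> ('v \<Rightarrow> 'v \<Rightarrow> 'f) \<Rightarrow> 'v \<Rightarrow> 'f set" where
  "q_bar \<sigma> h x = {h x x / 2 + \<nu> | \<nu>. \<nu> \<in> F_sigma \<sigma>}"

definition omega_bar :: "('f \<Rightarrow> ereal) \<Rightarrow> 'f set \<Rightarrow> ereal" where
  "omega_bar \<omega> C = (SUP t\<in>C. \<omega> t)"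

definition minorizes ::
  "('f::field \<Rightarrow> 'f) \<Rightarrow> ('f \<Rightarrow> ereal) \<Rightarrow> ('v \<Rightarrow> 'v \<Rightarrow> 'f) \<Rightarrow> ('v \<Rightarrow> ereal) \<Rightarrow> bool" where
  "minorizes \<sigma> \<omega> h \<alpha> \<longleftrightarrow>
     (\<forall>x y. \<alpha> x + \<alpha> y \<le> \<omega> (h x y)) \<and>
     (\<forall>x. \<alpha> x \<le> omega_bar \<omega> (q_bar \<sigma> h x) / 2)"

definition maxi_minorant_norms ::
  "('f::field \<Rightarrow> 'f) \<Rightarrow> ('f \<Rightarrow> ereal) \<Rightarrow> ('f \<Rightarrow> 'v::ab_group_add \<Rightarrow> 'v) \<Rightarrow> ('v \<Rightarrow> 'v \<Rightarrow> 'f)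
    \<Rightarrow> ('v \<Rightarrow> ereal) set" where
  "maxi_minorant_norms \<sigma> \<omega> s h =
     {\<alpha>. norm_on \<omega> s UNIV \<alpha> \<and> minorizes \<sigma> \<omega> h \<alpha> \<and>
         (\<forall>\<beta>. norm_on \<omega> s UNIV \<beta> \<and> minorizes \<sigma> \<omega> h \<beta> \<and> (\<forall>x. \<alpha> x \<le> \<beta> x) \<longrightarrow> \<beta> = \<alpha>)}"

section \<open>Graded lattice chains in a subspace\<close>

definition O_span ::
  "('f::field \<Rightarrow> ereal) \<Rightarrow> ('f \<Rightarrow> 'v::ab_group_add \<Rightarrow> 'v) \<Rightarrow> 'i set \<Rightarrow> ('i \<Rightarrow> 'v) \<Rightarrow> 'v set" where
  "O_span \<omega> s I w = {\<Sum>i\<in>I. s (a i) (w i) | a. \<forall>i\<in>I. a i \<in> ring_of_integers \<omega>}"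

text \<open>Lattices in \<open>W\<close> are the finitely generated \<open>O\<^sub>F\<close>-submodules that span \<open>W\<close> over \<open>F\<close>.\<close>
definition O_lattice ::
  "('f::field \<Rightarrow> ereal) \<Rightarrow> ('f \<Rightarrow> 'v::ab_group_add \<Rightarrow> 'v) \<Rightarrow> 'v set \<Rightarrow> 'v set \<Rightarrow> bool" where
  "O_lattice \<omega> s W X \<longleftrightarrow>
     (\<exists>B. finite B \<and> X = O_span \<omega> s B (\<lambda>b. b)) \<and> module.span s X = W"

definition O_basis ::
  "('f::field \<Rightarrow> ereal) \<Rightarrow> ('f \<Rightarrow> 'v::ab_group_add \<Rightarrow> 'v) \<Rightarrow> nat set \<Rightarrow> (nat \<Rightarrow> 'v) \<Rightarrow> 'v set \<Rightarrow> bool"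
  where
  "O_basis \<omega> s I w X \<longleftrightarrow>
     X = O_span \<omega> s I w \<and>
     (\<forall>a. (\<forall>i\<in>I. a i \<in> ring_of_integers \<omega>) \<and> (\<Sum>i\<in>I. s (a i) (w i)) = 0
        \<longrightarrow> (\<forall>i\<in>I. a i = 0))"

text \<open>A pair \<open>(L, c)\<close>; the values of \<open>c\<close> outside \<open>L\<close> are irrelevant.\<close>
type_synonym 'v graded_chain = "'v set set \<times> ('v set \<Rightarrow> real)"

definition graded_lattice_chain ::
  "('f::field \<Rightarrow> ereal) \<Rightarrow> ('f \<Rightarrow> 'v::ab_group_add \<Rightarrow> 'v) \<Rightarrow> 'v set \<Rightarrow> 'v graded_chain \<Rightarrow> bool" where
  "graded_lattice_chain \<omega> s W C \<longleftrightarrow> (case C of (L, c) \<Rightarrow>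
     L \<noteq> {} \<and> (\<forall>X\<in>L. O_lattice \<omega> s W X) \<and>
     (\<forall>X\<in>L. \<forall>Y\<in>L. X \<subseteq> Y \<or> Y \<subseteq> X) \<and>
     (\<forall>X\<in>L. \<forall>a. a \<noteq> 0 \<longrightarrow> s a ` X \<in> L) \<and>
     (\<forall>X\<in>L. \<forall>Y\<in>L. X \<subset> Y \<longrightarrow> c Y < c X) \<and>
     (\<forall>X\<in>L. \<forall>a. a \<noteq> 0 \<longrightarrow> ereal (c (s a ` X)) = \<omega> a + ereal (c X)))"

definition adapted_basis ::
  "('f::field \<Rightarrow> ereal) \<Rightarrow> ('f \<Rightarrow> 'v::ab_group_add \<Rightarrow> 'v) \<Rightarrow> 'v set \<Rightarrow> 'v graded_chain
    \<Rightarrow> nat set \<Rightarrow> (nat \<Rightarrow> 'v) \<Rightarrow> bool" where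
  "adapted_basis \<omega> s W C I v \<longleftrightarrow>
     is_basis s I v W \<and>
     (\<forall>X\<in>fst C. \<exists>a::nat \<Rightarrow> 'f. O_basis \<omega> s I (\<lambda>i. s (a i) (v i)) X)"

text \<open>The two directions of the correspondence between norms and graded lattice chains.\<close>
definition chain_of_norm ::
  "('f::field \<Rightarrow> ereal) \<Rightarrow> ('f \<Rightarrow> 'v::ab_group_add \<Rightarrow> 'v) \<Rightarrow> 'v set \<Rightarrow> ('v \<Rightarrow> ereal) \<Rightarrow> 'v graded_chain
    \<Rightarrow> bool" where
  "chain_of_norm \<omega> s W \<alpha> C \<longleftrightarrow> (case C of (L, c) \<Rightarrow>
     norm_on \<omega> s W \<alpha> \<and>
     L = {{x \<in> W. ereal r \<le> \<alpha> x} | r::real. True} \<and>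
     (\<forall>X\<in>L. ereal (c X) = (INF x\<in>X. \<alpha> x)))"

definition norm_of_chain :: "'v graded_chain \<Rightarrow> 'v \<Rightarrow> ereal" where
  "norm_of_chain C x = Sup {ereal (snd C X) | X. X \<in> fst C \<and> x \<in> X}"

definition subspace_sum :: "'v::ab_group_add set \<Rightarrow> 'v set \<Rightarrow> 'v set" where
  "subspace_sum U W = {x + y | x y. x \<in> U \<and> y \<in> W}"

text \<open>\<open>C\<close> is the direct sum of \<open>C1\<close> in \<open>W1\<close> and \<open>C2\<close> in \<open>W2\<close>.\<close>
definition chain_direct_sum ::
  "('f::field \<Rightarrow> ereal) \<Rightarrow> ('f \<Rightarrow> 'v::ab_group_add \<Rightarrow> 'v) \<Rightarrow> 'v set \<Rightarrow> 'v graded_chain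
    \<Rightarrow> 'v set \<Rightarrow> 'v graded_chain \<Rightarrow> 'v graded_chain \<Rightarrow> bool" where
  "chain_direct_sum \<omega> s W1 C1 W2 C2 C \<longleftrightarrow>
     W1 \<inter> W2 = {0} \<and>
     (\<exists>\<beta>. (\<forall>x1\<in>W1. \<forall>x2\<in>W2. \<beta> (x1 + x2) = min (norm_of_chain C1 x1) (norm_of_chain C2 x2)) \<and>
          chain_of_norm \<omega> s (subspace_sum W1 W2) \<beta> C)"

text \<open>\<open>C\<close> corresponds to the dual, for \<open>h\<close> restricted to \<open>W\<close>, of its own norm.\<close>
definition self_dual_chain ::
  "('f::field \<Rightarrow> ereal) \<Rightarrow> ('f \<Rightarrow> 'v::ab_group_add \<Rightarrow> 'v) \<Rightarrow> ('v \<Rightarrow> 'v \<Rightarrow> 'f) \<Rightarrow> 'v set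
    \<Rightarrow> 'v graded_chain \<Rightarrow> bool" where
  "self_dual_chain \<omega> s h W C \<longleftrightarrow>
     graded_lattice_chain \<omega> s W C \<and>
     chain_of_norm \<omega> s W (dual_norm \<omega> h W (norm_of_chain C)) C"

section \<open>Witt decompositions\<close>

definition totally_isotropic ::
  "('f::field \<Rightarrow> 'v::ab_group_add \<Rightarrow> 'v) \<Rightarrow> ('v \<Rightarrow> 'v \<Rightarrow> 'f) \<Rightarrow> 'v set \<Rightarrow> bool" where
  "totally_isotropic s h W \<longleftrightarrow> module.subspace s W \<and> (\<forall>x\<in>W. \<forall>y\<in>W. h x y = 0)"

definition maximal_isotropic ::
  "('f::field \<Rightarrow> 'v::ab_group_add \<Rightarrow> 'v) \<Rightarrow> ('v \<Rightarrow> 'v \<Rightarrow> 'f) \<Rightarrow> 'v set \<Rightarrow> bool" where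
  "maximal_isotropic s h W \<longleftrightarrow>
     totally_isotropic s h W \<and> (\<forall>U. totally_isotropic s h U \<and> W \<subseteq> U \<longrightarrow> U = W)"

definition V_minus ::
  "('f::field \<Rightarrow> 'v::ab_group_add \<Rightarrow> 'v) \<Rightarrow> nat \<Rightarrow> (nat \<Rightarrow> 'v) \<Rightarrow> 'v set" where
  "V_minus s m f = module.span s (f ` {1..m})"

definition V_zero ::
  "('f::field \<Rightarrow> 'v::ab_group_add \<Rightarrow> 'v) \<Rightarrow> nat \<Rightarrow> (nat \<Rightarrow> 'v) \<Rightarrow> 'v set" where
  "V_zero s m f = module.span s {f (m + 1)}"

definition V_plus ::
  "('f::field \<Rightarrow> 'v::ab_group_add \<Rightarrow> 'v) \<Rightarrow> nat \<Rightarrow> (nat \<Rightarrow> 'v) \<Rightarrow> 'v set" where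
  "V_plus s m f = module.span s (f ` {m + 2..2 * m + 1})"

abbreviation V_pm ::
  "('f::field \<Rightarrow> 'v::ab_group_add \<Rightarrow> 'v) \<Rightarrow> nat \<Rightarrow> (nat \<Rightarrow> 'v) \<Rightarrow> 'v set" where
  "V_pm s m f \<equiv> subspace_sum (V_minus s m f) (V_plus s m f)"

definition induces_Witt_decomposition ::
  "('f::field \<Rightarrow> 'v::ab_group_add \<Rightarrow> 'v) \<Rightarrow> ('v \<Rightarrow> 'v \<Rightarrow> 'f) \<Rightarrow> nat \<Rightarrow> (nat \<Rightarrow> 'v) \<Rightarrow> bool" where
  "induces_Witt_decomposition s h m f \<longleftrightarrow>
     maximal_isotropic s h (V_minus s m f) \<and>
     maximal_isotropic s h (V_plus s m f) \<and>
     V_zero s m f = {x. \<forall>y\<in>V_pm s m f. h x y = 0} \<and>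
     antidiagonal_on h (2 * m + 1) f"

end

theory Submission
  imports Defs
begin

text \<open>
  If \<open>\<alpha>\<close> is a minorant adapted to a Witt basis with dual values on the hyperbolic pairs and value
  \<open>\<delta>/2\<close> in the middle, then a larger minorant \<open>\<gamma>\<close> is bounded by \<open>\<alpha>\<close> on each coordinate: by duality
  with the partner vector off the middle, and by the quadratic condition at the middle vector.

  Conversely, let \<open>\<alpha>\<close> be maxi-minorant and \<open>u\<close> isotropic.  As \<open>\<omega>\<close> of the quadratic class of \<open>u\<close> is
  infinite, maximality gives that \<open>\<alpha> u\<close> equals the dual norm of \<open>u\<close>; the infimum defining it is
  attained because norms are discrete, so there is \<open>y\<close> with \<open>h u y = 1\<close> and \<open>\<alpha> y = - \<alpha> u\<close>.
  Choosing \<open>\<lambda>\<close> of trace \<open>h y y\<close> with \<open>\<omega> \<lambda> \<ge> 2 \<alpha> y\<close>, the vector \<open>v = y - \<lambda> u\<close> is isotropic of the same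
  norm, and the hyperbolic plane of \<open>u, v\<close> splits off orthogonally for \<open>\<alpha>\<close>.  Starting from an antidiagonal
  basis with \<open>u = e\<^sub>1\<close>, replacing \<open>e\<^sub>n\<close> by \<open>v\<close> and the inner \<open>e\<^sub>i\<close> by \<open>e\<^sub>i - h v e\<^sub>i u\<close> keeps the Gram matrix,
  and one continues inside.  The middle value is \<open>\<delta>/2\<close> since otherwise it could be enlarged.
\<close>

section \<open>Comparison of extended reals\<close>

text \<open>The reals are dense in the extended reals, so inequalities between valuations or norms
  can be tested at real thresholds. This keeps \<infinity> out of most of the later
  arithmetic.\<close>

lemma ereal_le_by_reals:
  fixes a b :: ereal
  assumes "\<And>r. ereal r < a \<Longrightarrow> ereal r \<le> b"
  shows "a \<le> b"
proof (rule ccontr)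
  assume "\<not> a \<le> b"
  then obtain r where "b < ereal r" "ereal r < a"
    using ereal_dense2 by (metis not_le)
  then show False
    using assms[of r] by simp
qed

lemma ereal_le_half_iff: "ereal r \<le> x / 2 \<longleftrightarrow> ereal (2 * r) \<le> x"
  by (cases x) auto

section \<open>The valued field\<close>

text \<open>The properties of \<open>F\<close> on which the rest is built: an isometric involution,
  and values in the half-integers, as the ramification index over \<open>F\<^sub>0\<close> is 2.
  Half-integrality is the source of every attained supremum; the element of value 1 makes the values
  unbounded.\<close>

locale valued_involution =
  fixes \<sigma> :: "'f::field_char_0 \<Rightarrow> 'f" and \<omega> :: "'f \<Rightarrow> ereal"
  assumes valuation: "is_valuation \<omega>"
    and half_integral: "x \<noteq> 0 \<Longrightarrow> \<exists>k::int. \<omega> x = ereal (of_int k / 2)"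
    and val_one_attained: "\<exists>p. \<omega> p = 1"
    and conj_add: "\<sigma> (x + y) = \<sigma> x + \<sigma> y"
    and conj_mult: "\<sigma> (x * y) = \<sigma> x * \<sigma> y"
    and conj_conj [simp]: "\<sigma> (\<sigma> x) = x"
    and val_conj [simp]: "\<omega> (\<sigma> x) = \<omega> x"
begin

lemma val_zero [simp]: "\<omega> 0 = \<infinity>"
  and val_eq_infinity: "\<omega> x = \<infinity> \<longleftrightarrow> x = 0"
  and val_mult: "\<omega> (x * y) = \<omega> x + \<omega> y"
  and val_not_minf [simp]: "\<omega> x \<noteq> -\<infinity>"
  using valuation by (auto simp: is_valuation_def)

lemma val_add: "r \<le> \<omega> x \<Longrightarrow> r \<le> \<omega> y \<Longrightarrow> r \<le> \<omega> (x + y)"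
  using valuation unfolding is_valuation_def by (meson min.boundedI order_trans)

lemma val_finite:
  assumes "x \<noteq> 0"
  obtains w where "\<omega> x = ereal w"
  using half_integral[OF assms] by blast

lemma val_one [simp]: "\<omega> 1 = 0"
proof -
  obtain w where w: "\<omega> 1 = ereal w" using val_finite[of 1] by auto
  have "\<omega> 1 = \<omega> 1 + \<omega> 1" using val_mult[of 1 1] by simp
  then show ?thesis using w by (simp add: zero_ereal_def)
qed

lemma val_minus [simp]: "\<omega> (- x) = \<omega> x"
proof -
  obtain w where w: "\<omega> (-1) = ereal w" using val_finite[of "-1"] by auto
  have "0 = \<omega> (-1) + \<omega> (-1)" using val_mult[of "-1" "-1"] by simp
  then have "\<omega> (-1) = 0" using w by (simp add: zero_ereal_def)
  then show ?thesis using val_mult[of "-1" x] by simp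
qed

lemma val_inverse: "\<omega> x = ereal w \<Longrightarrow> \<omega> (inverse x) = ereal (- w)"
proof -
  assume w: "\<omega> x = ereal w"
  then have "x \<noteq> 0" by auto
  then obtain v where v: "\<omega> (inverse x) = ereal v" using val_finite[of "inverse x"] by auto
  have "\<omega> x + \<omega> (inverse x) = 0" using val_mult[of x "inverse x"] \<open>x \<noteq> 0\<close> by simp
  then show ?thesis using v w by (simp add: zero_ereal_def)
qed

lemma val_sum: "(\<And>i. i \<in> I \<Longrightarrow> r \<le> \<omega> (g i)) \<Longrightarrow> r \<le> \<omega> (sum g I)"
  by (induction I rule: infinite_finite_induct) (auto intro: val_add)

lemma conj_zero [simp]: "\<sigma> 0 = 0"
  using conj_add[of 0 0] by simp

lemma conj_minus: "\<sigma> (- x) = - \<sigma> x"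
  using conj_add[of x "- x"] by (simp add: eq_neg_iff_add_eq_0 add.commute)

lemma conj_diff: "\<sigma> (x - y) = \<sigma> x - \<sigma> y"
  using conj_add[of x "- y"] by (simp add: conj_minus)

lemma conj_one [simp]: "\<sigma> 1 = 1"
proof -
  have "\<sigma> 1 \<noteq> 0" using conj_conj[of 1] by (metis conj_zero zero_neq_one)
  moreover have "\<sigma> 1 * \<sigma> 1 = \<sigma> 1" using conj_mult[of 1 1] by simp
  ultimately show ?thesis by simp
qed

lemma conj_two [simp]: "\<sigma> 2 = 2"
  using conj_add[of 1 1] by simp

lemma conj_half [simp]: "\<sigma> (x / 2) = \<sigma> x / 2"
  using conj_mult[of "x / 2" 2] by (simp add: field_simps)

lemma conj_eq_zero [simp]: "\<sigma> x = 0 \<longleftrightarrow> x = 0"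
  by (metis conj_conj conj_zero)

text \<open>The finite values are half-integers, hence discrete, and a bounded non-empty set of them
  has a largest element.\<close>

lemma val_max_attained:
  assumes "T \<noteq> {}" "\<And>x. x \<in> T \<Longrightarrow> \<omega> x \<le> ereal b"
  obtains x where "x \<in> T" "\<And>y. y \<in> T \<Longrightarrow> \<omega> y \<le> \<omega> x"
proof -
  have "\<exists>k::int. \<omega> x = ereal (of_int k / 2)" if "x \<in> T" for x
    using half_integral[of x] assms(2)[OF that] by (cases "x = 0") auto
  then obtain k :: "'f \<Rightarrow> int" where k: "\<And>x. x \<in> T \<Longrightarrow> \<omega> x = ereal (of_int (k x) / 2)"
    by metis
  \<comment> \<open>\<open>k x\<close> is twice the value of \<open>x\<close>, and \<open>g\<close>
    reverses its order, so a least \<open>g\<close> is a largest value. The bound \<open>kb\<close>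
    ensures that \<open>nat\<close> truncates nothing.\<close>
  define g where "g x = nat (\<lfloor>2 * b\<rfloor> - k x)" for x
  have kb: "k x \<le> \<lfloor>2 * b\<rfloor>" if "x \<in> T" for x
    using assms(2)[OF that] k[OF that] by (simp add: le_floor_iff)
  obtain x where x: "x \<in> T" "\<And>y. y \<in> T \<Longrightarrow> g x \<le> g y"
    using ex_has_least_nat[of "\<lambda>x. x \<in> T" _ g] assms(1) by blast
  have "\<omega> y \<le> \<omega> x" if "y \<in> T" for y
    using x(2)[OF that] kb[OF that] kb[OF x(1)] k[OF that] k[OF x(1)] by (auto simp: g_def)
  with x(1) show ?thesis using that by blast
qed

text \<open>The element \<open>a\<close> generates the fractional ideal of all \<open>x\<close> with
  \<open>t \<le> \<omega> x\<close>. Passing to inverses turns the least value into a largest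
  one.\<close>

lemma val_least_above:
  obtains a where "ereal t \<le> \<omega> a" "a \<noteq> 0" "\<And>x. ereal t \<le> \<omega> x \<Longrightarrow> \<omega> a \<le> \<omega> x"
proof -
  obtain p where p: "\<omega> p = 1" using val_one_attained by blast
  have pw: "\<omega> (p ^ j) = ereal (real j)" for j
    by (induction j) (auto simp: val_mult p one_ereal_def zero_ereal_def)
  have ne: "p ^ nat \<lceil>t\<rceil> \<noteq> 0" "ereal t \<le> \<omega> (p ^ nat \<lceil>t\<rceil>)"
    using pw[of "nat \<lceil>t\<rceil>"] by (auto simp del: power_eq_0_iff simp: real_nat_ceiling_ge)
  define T where "T = {x. x \<noteq> 0 \<and> ereal t \<le> \<omega> (inverse x)}"
  have "inverse (p ^ nat \<lceil>t\<rceil>) \<in> T" using ne by (auto simp: T_def)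
  moreover have "\<omega> x \<le> ereal (- t)" if x: "x \<in> T" for x
  proof -
    obtain w where w: "\<omega> x = ereal w" using x val_finite[of x] by (auto simp: T_def)
    then show ?thesis using x val_inverse[OF w] by (auto simp: T_def)
  qed
  ultimately obtain x where x: "x \<in> T" "\<And>y. y \<in> T \<Longrightarrow> \<omega> y \<le> \<omega> x"
    using val_max_attained[of T "- t"] by blast
  have "\<omega> (inverse x) \<le> \<omega> y" if y: "ereal t \<le> \<omega> y" for y
  proof (cases "y = 0")
    case False
    obtain w where w: "\<omega> y = ereal w" using False val_finite[of y] by auto
    obtain w' where w': "\<omega> x = ereal w'" using x val_finite[of x] by (auto simp: T_def)
    have "inverse y \<in> T" using False y by (auto simp: T_def)
    from x(2)[OF this] show ?thesis using val_inverse[OF w] val_inverse[OF w'] w w' by simp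
  qed simp
  with x(1) show ?thesis using that[of "inverse x"] by (auto simp: T_def)
qed

text \<open>Since \<sigma> is isometric, an element of trace 1 satisfies
  \<open>\<omega> t \<le> \<omega> 1 = 0\<close>; thus the supremum defining \<delta> is bounded and
  is a maximum. The element \<open>1 / 2\<close> shows that the set is non-empty.\<close>

lemma delta_attained:
  obtains t d where "t + \<sigma> t = 1" "\<omega> t = ereal d" "delta_inv \<sigma> \<omega> = ereal d" "d \<le> 0"
proof -
  have le: "\<omega> t \<le> ereal 0" if "t + \<sigma> t = 1" for t
    using val_add[of "\<omega> t" t "\<sigma> t"] that by (simp add: zero_ereal_def)
  have "1 / 2 \<in> {t. t + \<sigma> t = 1}" by simp
  then obtain t where t: "t + \<sigma> t = 1" "\<And>y. y + \<sigma> y = 1 \<Longrightarrow> \<omega> y \<le> \<omega> t"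
    using le by (rule_tac val_max_attained[of "{t. t + \<sigma> t = 1}" 0]) blast+
  have "t \<noteq> 0" using t(1) by auto
  then obtain d where d: "\<omega> t = ereal d" using val_finite by blast
  have "delta_inv \<sigma> \<omega> = \<omega> t"
    unfolding delta_inv_def using t by (intro antisym Sup_least Sup_upper) auto
  then show ?thesis using that t d le[OF t(1)] by auto
qed

end

text \<open>Why \<open>\<omega> \<circ> \<sigma> = \<omega>\<close>: if \<open>p\<close> has non-integral valuation, then
  \<open>p + \<sigma> p\<close> and \<open>p * \<sigma> p\<close> have integral valuation, which forces \<open>\<omega> (\<sigma> p) = \<omega> p\<close>.\<close>
lemma (in ramified_dyadic_extension) valued_involution: "valued_involution \<sigma> \<omega>"
proof -
  have v0 [simp]: "\<omega> 0 = \<infinity>" and vinf: "\<And>x. \<omega> x = \<infinity> \<longleftrightarrow> x = 0"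
    and vmul: "\<And>x y. \<omega> (x * y) = \<omega> x + \<omega> y" and vminf: "\<And>x. \<omega> x \<noteq> -\<infinity>"
    and vadd: "\<And>x y. min (\<omega> x) (\<omega> y) \<le> \<omega> (x + y)"
    using valuation by (auto simp: is_valuation_def)
  have fin: "\<exists>w. \<omega> x = ereal w" if "x \<noteq> 0" for x
    using vinf[of x] vminf[of x] that by (cases "\<omega> x") auto
  have v1: "\<omega> 1 = 0"
    using vmul[of 1 1] fin[of 1] by (auto simp: zero_ereal_def)
  have "\<omega> (-1) = 0"
    using vmul[of "-1" "-1"] fin[of "-1"] v1 by (auto simp: zero_ereal_def)
  then have vneg: "\<omega> (- x) = \<omega> x" for x
    using vmul[of "-1" x] by simp
  have vadd_eq: "\<omega> (x + y) = \<omega> x" if "\<omega> x < \<omega> y" for x y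
  proof (rule antisym)
    have "min (\<omega> (x + y)) (\<omega> y) \<le> \<omega> x"
      using vadd[of "x + y" "- y"] vneg[of y] by simp
    then show "\<omega> (x + y) \<le> \<omega> x" using that by (auto simp: min_def split: if_splits)
    show "\<omega> x \<le> \<omega> (x + y)" using vadd[of x y] that by (simp add: min_def less_imp_le)
  qed
  have sub: "0 \<in> F\<^sub>0" "1 \<in> F\<^sub>0" "\<And>x. x \<in> F\<^sub>0 \<Longrightarrow> - x \<in> F\<^sub>0" "\<And>x. x \<in> F\<^sub>0 \<Longrightarrow> inverse x \<in> F\<^sub>0"
    "\<And>x y. x \<in> F\<^sub>0 \<Longrightarrow> y \<in> F\<^sub>0 \<Longrightarrow> x + y \<in> F\<^sub>0" "\<And>x y. x \<in> F\<^sub>0 \<Longrightarrow> y \<in> F\<^sub>0 \<Longrightarrow> x * y \<in> F\<^sub>0"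
    using finite_ext by (auto simp: finite_field_extension_def is_subfield_def)
  have sub': "\<And>x y. x \<in> F\<^sub>0 \<Longrightarrow> y \<in> F\<^sub>0 \<Longrightarrow> x - y \<in> F\<^sub>0" "\<And>x y. x \<in> F\<^sub>0 \<Longrightarrow> y \<in> F\<^sub>0 \<Longrightarrow> x / y \<in> F\<^sub>0"
    by (simp_all add: sub divide_inverse diff_conv_add_uminus del: add_uminus_conv_diff)
  have int: "\<exists>k::int. \<omega> x = ereal (of_int k)" if "x \<in> F\<^sub>0" "x \<noteq> 0" for x
    using normalized that by blast
  have onto: "\<exists>x\<in>F\<^sub>0 - {0}. \<omega> x = ereal (of_int k)" for k :: int
    using normalized by (metis imageE rangeI)
  have "\<exists>p. p \<noteq> 0 \<and> \<omega> p \<notin> range (\<lambda>k::int. ereal (of_int k))"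
  proof (rule ccontr)
    assume "\<not> ?thesis"
    then have "\<omega> ` (UNIV - {0}) \<subseteq> \<omega> ` (F\<^sub>0 - {0})" using normalized by blast
    then show False using ramified by blast
  qed
  then obtain p where p: "p \<noteq> 0" "\<And>k::int. \<omega> p \<noteq> ereal (of_int k)" by blast
  obtain r where r: "\<omega> p = ereal r" using fin p by blast
  have r_int: "r \<noteq> of_int k" for k :: int using p(2) r by auto
  obtain \<theta> where \<theta>: "\<And>x. \<exists>a\<in>F\<^sub>0. \<exists>b\<in>F\<^sub>0. x = a + b * \<theta>"
    using quadratic by blast
  \<comment> \<open>The value of \<open>p\<close> is not integral, so \<open>p\<close> is not in
    \<open>F\<^sub>0\<close>. Hence its coefficient at \<open>\<theta>\<close> is non-zero and
    \<open>\<theta>\<close> can be replaced by \<open>p\<close> as a generator.\<close>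
  have gen: "\<exists>a\<in>F\<^sub>0. \<exists>b\<in>F\<^sub>0. x = a + b * p" for x
  proof -
    obtain a b where ab: "a \<in> F\<^sub>0" "b \<in> F\<^sub>0" "p = a + b * \<theta>" using \<theta> by blast
    have "b \<noteq> 0" using ab int[of p] p by auto
    obtain a' b' where ab': "a' \<in> F\<^sub>0" "b' \<in> F\<^sub>0" "x = a' + b' * \<theta>" using \<theta> by blast
    have "\<theta> = (p - a) / b" using ab(3) \<open>b \<noteq> 0\<close> by simp
    then have "x = (a' - b' * a / b) + (b' / b) * p" 
      using ab'(3) \<open>b \<noteq> 0\<close> by (simp add: diff_divide_distrib right_diff_distrib left_diff_distrib)
    moreover have "a' - b' * a / b \<in> F\<^sub>0" "b' / b \<in> F\<^sub>0" 
      by (intro sub' sub(6) ab ab')+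
    ultimately show ?thesis by blast
  qed
  have nonint: "\<omega> a \<noteq> \<omega> (b * q)"
    if ab: "a \<in> F\<^sub>0" "b \<in> F\<^sub>0" "b \<noteq> 0" "\<omega> q = ereal t" "\<And>k::int. t \<noteq> of_int k" for a b q t
  proof
    assume eq: "\<omega> a = \<omega> (b * q)"
    obtain k :: int where k: "\<omega> b = ereal (of_int k)" using int ab by blast
    have "a \<noteq> 0" using eq ab k by (auto simp: vmul)
    then obtain l :: int where l: "\<omega> a = ereal (of_int l)" using int ab by blast
    have "t = of_int (l - k)" using eq k l ab by (auto simp: vmul)
    then show False using ab by blast
  qed
  \<comment> \<open>One summand has integral value and the other does not, so the values differ and
    nothing cancels. This is applied to \<open>q = p\<close> and to
    \<open>q = \<sigma> p\<close>.\<close>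
  have lin: "\<omega> (a + b * q) = min (\<omega> a) (\<omega> b + \<omega> q)"
    if "a \<in> F\<^sub>0" "b \<in> F\<^sub>0" "\<omega> q = ereal t" "\<And>k::int. t \<noteq> of_int k" for a b q t
  proof (cases "b = 0")
    case False
    then show ?thesis
      using nonint[OF that(1,2) False that(3,4)] vadd_eq[of a "b * q"] vadd_eq[of "b * q" a]
      by (auto simp: vmul min_def add.commute)
  qed (use that in simp)
  \<comment> \<open>Trace and norm of \<open>p\<close> turn out to be \<open>T\<close> and
    \<open>- N\<close>: the conjugate satisfies the same quadratic equation and differs from
    \<open>p\<close>, so it is the other root \<open>T - p\<close>.\<close>
  obtain N T where NT: "N \<in> F\<^sub>0" "T \<in> F\<^sub>0" "p * p = N + T * p" using gen by blast
  have sp: "\<sigma> (a + b * p) = a + b * \<sigma> p" if "a \<in> F\<^sub>0" "b \<in> F\<^sub>0" for a b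
    using that by (simp add: conj_add conj_mult conj_fixes)
  have "\<sigma> p * \<sigma> p = N + T * \<sigma> p"
    using sp[OF NT(1,2)] NT(3) conj_mult[of p p] by simp
  then have "(\<sigma> p - p) * (\<sigma> p - (T - p)) = 0"
    using NT(3) by (simp add: algebra_simps)
  moreover have "\<sigma> p \<noteq> p"
  proof
    assume "\<sigma> p = p"
    have "\<sigma> x = x" for x
    proof -
      obtain a b where ab: "a \<in> F\<^sub>0" "b \<in> F\<^sub>0" "x = a + b * p" using gen by blast
      then show ?thesis using sp[OF ab(1,2)] \<open>\<sigma> p = p\<close> by simp
    qed
    then show False using conj_nontrivial by (metis eq_id_iff)
  qed
  ultimately have sigp: "\<sigma> p = T - p" by (metis mult_eq_0_iff right_minus_eq)
  have "p * \<sigma> p = - N" unfolding sigp by (simp add: right_diff_distrib NT(3) mult.commute)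
  moreover from this have "N \<noteq> 0"
  proof -
    have "T \<noteq> p" using p int[OF NT(2)] by blast
    then have "\<sigma> p \<noteq> 0" using sigp by simp
    then show "N \<noteq> 0" using \<open>p * \<sigma> p = - N\<close> p(1) by auto
  qed
  ultimately obtain kN :: int where kN: "\<omega> (p * \<sigma> p) = ereal (of_int kN)"
    using int[OF NT(1)] vneg by auto
  have "\<sigma> p \<noteq> 0" using kN by auto
  then obtain r' where r': "\<omega> (\<sigma> p) = ereal r'" using fin by blast
  have rr': "r + r' = of_int kN" using kN r r' by (simp add: vmul)
  have "r' \<noteq> of_int k" for k :: int
    using rr' r_int[of "kN - k"] by auto
  \<comment> \<open>If the two values differed, their minimum would be the value of the trace
    \<open>T\<close>, an element of \<open>F\<^sub>0\<close>; but neither of them is an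
    integer.\<close>
  have r'_eq: "r' = r"
  proof (rule ccontr)
    assume ne: "r' \<noteq> r"
    have m: "\<omega> T = ereal (min r r')"
      using vadd_eq[of p "\<sigma> p"] vadd_eq[of "\<sigma> p" p] ne r r' sigp
      by (cases "r < r'") (simp_all add: min_def)
    then have "T \<noteq> 0" using v0 by (metis PInfty_neq_ereal(1))
    then obtain k :: int where "\<omega> T = ereal (of_int k)" using int[OF NT(2)] by blast
    then have "min r r' = of_int k" using m by (metis ereal.inject)
    then show False using r_int[of k] \<open>\<And>k. r' \<noteq> of_int k\<close>[of k] by (cases "r \<le> r'") simp_all
  qed
  have vconj: "\<omega> (\<sigma> x) = \<omega> x" for x
  proof -
    obtain a b where ab: "a \<in> F\<^sub>0" "b \<in> F\<^sub>0" "x = a + b * p" using gen by blast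
    have "\<omega> (a + b * \<sigma> p) = min (\<omega> a) (\<omega> b + \<omega> (\<sigma> p))"
      using lin[OF ab(1,2) _ r_int] r' r'_eq by blast
    then show ?thesis
      using lin[OF ab(1,2) r r_int] unfolding ab(3) sp[OF ab(1,2)] r r' r'_eq by metis
  qed
  have half: "\<exists>k::int. \<omega> x = ereal (of_int k / 2)" if "x \<noteq> 0" for x
  proof -
    obtain a b where ab: "a \<in> F\<^sub>0" "b \<in> F\<^sub>0" "x = a + b * p" using gen by blast
    have m: "\<omega> x = min (\<omega> a) (\<omega> b + ereal r)"
      using lin[OF ab(1,2) r r_int] ab(3) r by simp
    have A: "\<exists>k::int. \<omega> a = ereal (of_int k / 2)" if nz: "a \<noteq> 0"
    proof -
      obtain k :: int where "\<omega> a = ereal (of_int k)" using int ab nz by blast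
      then show ?thesis by (intro exI[of _ "2 * k"]) simp
    qed
    \<comment> \<open>As \<open>r' = r\<close> and \<open>r + r' = kN\<close>, twice
      \<open>r\<close> is the integer \<open>kN\<close>.\<close>
    have B: "\<exists>k::int. \<omega> b + ereal r = ereal (of_int k / 2)" if nz: "b \<noteq> 0"
    proof -
      obtain k :: int where "\<omega> b = ereal (of_int k)" using int ab nz by blast
      then show ?thesis using rr' r'_eq by (intro exI[of _ "2 * k + kN"]) (auto simp: field_simps)
    qed
    show ?thesis
    proof (cases "\<omega> a \<le> \<omega> b + ereal r")
      case True
      then have "\<omega> x = \<omega> a" using m by (simp add: min_def)
      moreover from this have "a \<noteq> 0" using \<open>x \<noteq> 0\<close> vinf by metis
      ultimately show ?thesis using A by metis
    next
      case False
      then have "\<omega> x = \<omega> b + ereal r" using m by (simp add: min_def)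
      moreover have "b \<noteq> 0" using False by auto
      ultimately show ?thesis using B by metis
    qed
  qed
  have "\<sigma> (\<sigma> x) = x" for x
  proof -
    obtain a b where ab: "a \<in> F\<^sub>0" "b \<in> F\<^sub>0" "x = a + b * p" using gen by blast
    have "\<sigma> (\<sigma> p) = p"
      using sigp conj_add[of "T - p" p] conj_fixes[OF NT(2)] by simp
    then show ?thesis
      unfolding ab(3) sp[OF ab(1,2)] by (simp add: conj_add conj_mult conj_fixes ab)
  qed
  moreover have "\<exists>p. \<omega> p = 1"
    using onto[of 1] by (auto simp: one_ereal_def)
  ultimately show ?thesis
    using valuation half vconj conj_add conj_mult by (intro valued_involution.intro)
qed

section \<open>Antidiagonal bases\<close>

locale dyadic_split_space =
  valued_involution \<sigma> \<omega> + split_hermitian_space s \<sigma> h n m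
  for \<sigma> :: "'f::field_char_0 \<Rightarrow> 'f" and \<omega> :: "'f \<Rightarrow> ereal"
    and s :: "'f \<Rightarrow> 'v::ab_group_add \<Rightarrow> 'v" and h :: "'v \<Rightarrow> 'v \<Rightarrow> 'f" and n m :: nat
begin

lemma h_add_right: "h x (y + z) = h x y + h x z"
  and h_scale_right: "h x (s a y) = a * h x y"
  and h_swap: "h y x = \<sigma> (h x y)"
  using hermitian unfolding hermitian_form_def by blast+

lemma h_add_left: "h (x + y) z = h x z + h y z"
  by (subst (1 2 3) h_swap) (simp add: h_add_right conj_add)

lemma h_scale_left: "h (s a x) y = \<sigma> a * h x y"
  by (subst (1 2) h_swap) (simp add: h_scale_right conj_mult)

lemma h_zero_right [simp]: "h x 0 = 0"
  using h_add_right[of x 0 0] by simp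

lemma h_zero_left [simp]: "h 0 x = 0"
  using h_add_left[of 0 0 x] by simp

lemma h_diff_right: "h x (y - z) = h x y - h x z"
  using h_add_right[of x "y - z" z] by simp

lemma h_diff_left: "h (x - y) z = h x z - h y z"
  using h_add_left[of "x - y" y z] by simp

lemma h_sum_right: "h x (sum g I) = (\<Sum>i\<in>I. h x (g i))"
  by (induction I rule: infinite_finite_induct) (auto simp: h_add_right)

lemma h_sum_left: "h (sum g I) x = (\<Sum>i\<in>I. h (g i) x)"
  by (induction I rule: infinite_finite_induct) (auto simp: h_add_left)

lemma antidiagonalD:
  "antidiagonal_on h n e \<Longrightarrow> i \<in> {1..n} \<Longrightarrow> j \<in> {1..n} \<Longrightarrow> h (e i) (e j) = (if i = n + 1 - j then 1 else 0)"
  by (simp add: antidiagonal_on_def)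

text \<open>With respect to \<open>h\<close>, the vector dual to \<open>e i\<close> is
  \<open>e (n + 1 - i)\<close>. Pairing with it on the left, where the other argument is linear,
  serves as the coordinate function throughout.\<close>

lemma antidiagonal_coord:
  assumes "antidiagonal_on h n e" "I \<subseteq> {1..n}" "i \<in> {1..n}"
  shows "h (e (n + 1 - i)) (\<Sum>j\<in>I. s (a j) (e j)) = (if i \<in> I then a i else 0)"
proof -
  have fin: "finite I" using assms(2) finite_subset by blast
  have "h (e (n + 1 - i)) (\<Sum>j\<in>I. s (a j) (e j)) = (\<Sum>j\<in>I. if j = i then a j else 0)"
    unfolding h_sum_right h_scale_right
  proof (rule sum.cong)
    fix j assume "j \<in> I"
    then have j: "j \<in> {1..n}" using assms(2) by blast
    have "n + 1 - i \<in> {1..n}" using assms(3) by auto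
    moreover have "n + 1 - i = n + 1 - j \<longleftrightarrow> j = i" using j assms(3) by auto
    ultimately show "a j * h (e (n + 1 - i)) (e j) = (if j = i then a j else 0)"
      using antidiagonalD[OF assms(1) _ j] by simp
  qed simp
  then show ?thesis using fin by (simp add: sum.delta')
qed

lemma antidiagonal_inj:
  assumes "antidiagonal_on h n e"
  shows "inj_on e {1..n}"
proof (rule inj_onI)
  fix i j assume ij: "i \<in> {1..n}" "j \<in> {1..n}" "e i = e j"
  have k: "n + 1 - i \<in> {1..n}" using ij by auto
  have "h (e (n + 1 - i)) (e i) = 1" "h (e (n + 1 - i)) (e j) = (if n + 1 - i = n + 1 - j then 1 else 0)"
    using antidiagonalD[OF assms k ij(1)] antidiagonalD[OF assms k ij(2)] by simp_all
  then have "n + 1 - i = n + 1 - j" using ij(3) by (metis zero_neq_one)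
  then show "i = j" using ij by auto
qed

lemma antidiagonal_independent:
  assumes e: "antidiagonal_on h n e" and I: "I \<subseteq> {1..n}"
  shows "independent (e ` I)"
proof -
  have fin: "finite I" using I finite_subset by blast
  have inj: "inj_on e I" using antidiagonal_inj[OF e] I inj_on_subset by blast
  have "u (e i) = 0" if "(\<Sum>v\<in>e ` I. s (u v) v) = 0" "i \<in> I" for u i
  proof -
    have "(\<Sum>j\<in>I. s (u (e j)) (e j)) = 0" using that(1) by (simp add: sum.reindex[OF inj])
    then show ?thesis using antidiagonal_coord[OF e I, of i "\<lambda>j. u (e j)"] that(2) I by (auto simp: subset_iff)
  qed
  then have "\<not> (\<exists>u. (\<exists>v\<in>e ` I. u v \<noteq> 0) \<and> (\<Sum>v\<in>e ` I. s (u v) v) = 0)" by blast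
  then show ?thesis using dependent_finite[of "e ` I"] fin by simp
qed

lemma ex_spanning: "\<exists>T. finite T \<and> card T = n \<and> span T = UNIV"
proof -
  obtain e where e: "is_basis s {1..n} e UNIV" using split by blast
  then have "card (e ` {1..n}) = n" "span (e ` {1..n}) = UNIV"
    unfolding is_basis_def by (simp_all add: card_image)
  then show ?thesis by blast
qed

lemma independent_card_le:
  assumes "independent B"
  shows "finite B \<and> card B \<le> n"
  using ex_spanning independent_span_bound[OF _ assms] by (metis subset_UNIV)

text \<open>The Gram matrix alone makes the family independent, and \<open>n\<close> independent
  vectors span because independent sets have at most \<open>n\<close> elements. Later arguments can
  thus carry only the Gram matrix along.\<close>

lemma antidiagonal_is_basis:
  assumes e: "antidiagonal_on h n e"
  shows "is_basis s {1..n} e UNIV"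
proof -
  have ind: "independent (e ` {1..n})" using antidiagonal_independent[OF e] by simp
  have card: "card (e ` {1..n}) = n" using card_image[OF antidiagonal_inj[OF e]] by simp
  have "x \<in> span (e ` {1..n})" for x
  proof (rule ccontr)
    assume x: "x \<notin> span (e ` {1..n})"
    then have "independent (insert x (e ` {1..n}))" using ind by (simp add: independent_insert)
    moreover have "x \<notin> e ` {1..n}" using x span_base by blast
    ultimately show False using independent_card_le card by fastforce
  qed
  then show ?thesis unfolding is_basis_def using antidiagonal_inj[OF e] ind by blast
qed

lemma span_coord:
  assumes e: "antidiagonal_on h n e" and I: "I \<subseteq> {1..n}" and x: "x \<in> span (e ` I)"
  shows "x = (\<Sum>i\<in>I. s (h (e (n + 1 - i)) x) (e i))"
    and "i \<in> {1..n} - I \<Longrightarrow> h (e (n + 1 - i)) x = 0"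
proof -
  have fin: "finite I" using I finite_subset by blast
  have inj: "inj_on e I" using antidiagonal_inj[OF e] I inj_on_subset by blast
  obtain u where "x = (\<Sum>v\<in>e ` I. s (u v) v)" using x fin by (auto simp: span_finite)
  then have u: "x = (\<Sum>j\<in>I. s (u (e j)) (e j))" by (simp add: sum.reindex[OF inj])
  have "h (e (n + 1 - i)) x = u (e i)" if "i \<in> I" for i
    using antidiagonal_coord[OF e I, of i "\<lambda>j. u (e j)"] that I u by auto
  then show "x = (\<Sum>i\<in>I. s (h (e (n + 1 - i)) x) (e i))" using u by simp
  show "h (e (n + 1 - i)) x = 0" if "i \<in> {1..n} - I"
    using antidiagonal_coord[OF e I, of i "\<lambda>j. u (e j)"] that u by simp
qed

lemma expand:
  assumes e: "antidiagonal_on h n e"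
  shows "x = (\<Sum>i\<in>{1..n}. s (h (e (n + 1 - i)) x) (e i))"
  using span_coord(1)[OF e subset_refl] antidiagonal_is_basis[OF e] by (simp add: is_basis_def)

lemma span_iff_coord:
  assumes e: "antidiagonal_on h n e" and I: "I \<subseteq> {1..n}"
  shows "x \<in> span (e ` I) \<longleftrightarrow> (\<forall>i\<in>{1..n} - I. h (e (n + 1 - i)) x = 0)"
proof
  assume r: "\<forall>i\<in>{1..n} - I. h (e (n + 1 - i)) x = 0"
  have "x = (\<Sum>i\<in>I. s (h (e (n + 1 - i)) x) (e i))"
    by (subst expand[OF e], rule sum.mono_neutral_right) (use I r in auto)
  also have "\<dots> \<in> span (e ` I)" by (intro span_sum span_scale span_base imageI)
  finally show "x \<in> span (e ` I)" .
qed (use span_coord(2)[OF e I] in blast)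

section \<open>Norms\<close>

lemma norm_ge_scale:
  assumes N: "norm_on \<omega> s W \<alpha>" and x: "x \<in> W" and r: "ereal r \<le> \<alpha> x" and w: "ereal w \<le> \<omega> a"
  shows "ereal (w + r) \<le> \<alpha> (s a x)"
proof -
  have "ereal w + ereal r \<le> \<omega> a + \<alpha> x" by (rule add_mono[OF w r])
  then show ?thesis using N x by (simp add: norm_on_def)
qed

lemma norm_finite:
  assumes N: "norm_on \<omega> s W \<alpha>" and x: "x \<in> W" "x \<noteq> 0"
  obtains r where "\<alpha> x = ereal r"
  using assms unfolding norm_on_def by (metis ereal_cases)

lemma norm_zero:
  assumes N: "norm_on \<omega> s W \<alpha>" and x: "0 \<in> W"
  shows "\<alpha> 0 = \<infinity>"
  using assms unfolding norm_on_def by blast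

lemma norm_scale:
  assumes N: "norm_on \<omega> s W \<alpha>" and x: "x \<in> W"
  shows "\<alpha> (s a x) = \<omega> a + \<alpha> x"
  using assms unfolding norm_on_def by blast

lemma norm_ge_add:
  assumes N: "norm_on \<omega> s UNIV \<alpha>" and "r \<le> \<alpha> x" "r \<le> \<alpha> y"
  shows "r \<le> \<alpha> (x + y)"
  using assms unfolding norm_on_def by (meson UNIV_I min.boundedI order_trans)

lemma norm_ge_minus:
  assumes N: "norm_on \<omega> s UNIV \<alpha>" and "r \<le> \<alpha> x"
  shows "r \<le> \<alpha> (- x)"
  using norm_scale[OF N UNIV_I, of "-1" x] assms(2) by simp

lemma norm_ge_diff:
  assumes N: "norm_on \<omega> s UNIV \<alpha>" and "r \<le> \<alpha> x" "r \<le> \<alpha> y"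
  shows "r \<le> \<alpha> (x - y)"
  using norm_ge_add[OF N assms(2) norm_ge_minus[OF N assms(3)]] by simp

lemma norm_ge_sum:
  assumes N: "norm_on \<omega> s UNIV \<alpha>" and "\<And>i. i \<in> I \<Longrightarrow> r \<le> \<alpha> (g i)"
  shows "r \<le> \<alpha> (sum g I)"
  using assms(2)
  by (induction I rule: infinite_finite_induct) (auto simp: norm_zero[OF N] intro: norm_ge_add[OF N])

lemma norm_gt_sum:
  assumes N: "norm_on \<omega> s UNIV \<alpha>" and "\<And>i. i \<in> I \<Longrightarrow> ereal r < \<alpha> (g i)"
  shows "ereal r < \<alpha> (sum g I)"
  using assms(2)
proof (induction I rule: infinite_finite_induct)
  case (insert x F)
  have "ereal r < min (\<alpha> (g x)) (\<alpha> (sum g F))" using insert by auto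
  also have "\<dots> \<le> \<alpha> (g x + sum g F)" using N unfolding norm_on_def by blast
  finally show ?case using insert by simp
qed (auto simp: norm_zero[OF N])

lemma norm_on_subset: "norm_on \<omega> s W \<alpha> \<Longrightarrow> U \<subseteq> W \<Longrightarrow> norm_on \<omega> s U \<alpha>"
  unfolding norm_on_def by blast

text \<open>Values of \<open>\<omega>\<close> are half-integers, so scalars cannot make such norms coincide.\<close>
lemma independent_if_close_norms:
  assumes N: "norm_on \<omega> s UNIV \<alpha>" and fin: "finite B" and inj: "inj_on \<alpha> B"
    and close: "\<And>x. x \<in> B \<Longrightarrow> ereal (b - 1 / 2) < \<alpha> x \<and> \<alpha> x \<le> ereal b"
  shows "independent B"
proof -
  have False if u: "(\<Sum>v\<in>B. s (u v) v) = 0" "v1 \<in> B" "u v1 \<noteq> 0" for u v1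
  proof -
    define B0 where "B0 = {v\<in>B. u v \<noteq> 0}"
    have B0: "finite B0" "v1 \<in> B0" using fin u by (auto simp: B0_def)
    have "\<exists>k::int. \<exists>a. \<alpha> v = ereal a \<and> \<omega> (u v) = ereal (of_int k / 2)" if v: "v \<in> B0" for v
      using half_integral[of "u v"] close[of v] v by (cases "\<alpha> v") (auto simp: B0_def)
    then obtain k :: "'v \<Rightarrow> int" and a where ka:
      "\<And>v. v \<in> B0 \<Longrightarrow> \<alpha> v = ereal (a v) \<and> \<omega> (u v) = ereal (of_int (k v) / 2)" by metis
    have val: "\<alpha> (s (u v) v) = ereal (of_int (k v) / 2 + a v)" if "v \<in> B0" for v
      using ka[OF that] norm_scale[OF N UNIV_I, of "u v" v] by simp
    \<comment> \<open>Equality would make \<open>a v - a w\<close> a half-integer of absolute value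
      less than 1/2, hence 0, against injectivity of \<alpha> on \<open>B\<close>.\<close>
    have dist: "of_int (k v) / 2 + a v \<noteq> of_int (k w) / 2 + a w" if vw: "v \<in> B0" "w \<in> B0" "v \<noteq> w" for v w
    proof
      assume eq: "of_int (k v) / 2 + a v = of_int (k w) / 2 + a w"
      have "b - 1/2 < a v" "a v \<le> b" "b - 1/2 < a w" "a w \<le> b"
        using close[of v] close[of w] ka vw by (auto simp: B0_def)
      then have "\<bar>of_int (k v) - of_int (k w) :: real\<bar> < 1" using eq by argo
      then have "k v = k w" by linarith
      then have "\<alpha> v = \<alpha> w" using eq ka vw by simp
      then show False using inj vw by (auto simp: B0_def inj_on_def)
    qed
    \<comment> \<open>The term at \<open>w\<close> has the strictly smallest norm. Solving the
      relation for it writes it as a sum of terms of strictly larger norm, which is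
      impossible.\<close>
    define w where "w = arg_min_on (\<lambda>v. of_int (k v) / 2 + a v) B0"
    have w: "w \<in> B0" "\<And>v. v \<in> B0 \<Longrightarrow> of_int (k w) / 2 + a w \<le> of_int (k v) / 2 + a v"
      unfolding w_def
      using B0 arg_min_if_finite(1)[of B0] arg_min_least[of B0, where f = "\<lambda>v. of_int (k v) / 2 + a v"]
      by blast+
    have "(\<Sum>v\<in>B0. s (u v) v) = 0"
      using u(1) sum.mono_neutral_right[of B B0 "\<lambda>v. s (u v) v"] fin by (auto simp: B0_def)
    then have "s (u w) w + (\<Sum>v\<in>B0 - {w}. s (u v) v) = 0"
      using sum.remove[OF B0(1) w(1), of "\<lambda>v. s (u v) v"] by simp
    then have "s (u w) w = - (\<Sum>v\<in>B0 - {w}. s (u v) v)"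
      by (simp add: eq_neg_iff_add_eq_0)
    also have "\<dots> = (\<Sum>v\<in>B0 - {w}. s (- u v) v)" by (simp add: sum_negf)
    finally have eq: "s (u w) w = (\<Sum>v\<in>B0 - {w}. s (- u v) v)" .
    have "ereal (of_int (k w) / 2 + a w) < \<alpha> (\<Sum>v\<in>B0 - {w}. s (- u v) v)"
    proof (rule norm_gt_sum[OF N])
      fix v assume v: "v \<in> B0 - {w}"
      have "\<alpha> (s (- u v) v) = \<alpha> (s (u v) v)" 
        using norm_scale[OF N UNIV_I, of "- u v" v] norm_scale[OF N UNIV_I, of "u v" v]
        by (simp del: scale_minus_left)
      then show "ereal (of_int (k w) / 2 + a w) < \<alpha> (s (- u v) v)"
        using val[of v] w(2)[of v] dist[of v w] v w(1) by simp
    qed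
    then show False using val[OF w(1)] eq by simp
  qed
  then have "\<not> (\<exists>u. (\<exists>v\<in>B. u v \<noteq> 0) \<and> (\<Sum>v\<in>B. s (u v) v) = 0)" by blast
  then show ?thesis using dependent_finite[of B] fin by simp
qed

text \<open>If the supremum \<open>b\<close> of the values were not attained, infinitely many values
  would lie within 1/2 below \<open>b\<close>. Vectors realizing \<open>n + 1\<close> of them would
  be independent, too many for the dimension.\<close>

lemma norm_max_attained:
  assumes N: "norm_on \<omega> s UNIV \<alpha>" and ne: "S \<noteq> {}" and bd: "\<And>y. y \<in> S \<Longrightarrow> \<alpha> y \<le> ereal b0"
  obtains y where "y \<in> S" "\<And>z. z \<in> S \<Longrightarrow> \<alpha> z \<le> \<alpha> y"
proof (rule ccontr)
  assume no: "\<not> thesis"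
  define A where "A = {r. \<exists>y\<in>S. \<alpha> y = ereal r}"
  have fin: "\<exists>r. \<alpha> y = ereal r" if "y \<in> S" for y
    using bd[OF that] N by (cases "\<alpha> y") (auto simp: norm_on_def)
  have A: "A \<noteq> {}" "bdd_above A"
  proof -
    show "A \<noteq> {}" using ne fin unfolding A_def by blast
    show "bdd_above A"
    proof (rule bdd_aboveI[of _ b0])
      fix r assume "r \<in> A"
      then obtain y where "y \<in> S" "\<alpha> y = ereal r" by (auto simp: A_def)
      then show "r \<le> b0" using bd[of y] by simp
    qed
  qed
  define b where "b = Sup A"
  define A' where "A' = {r \<in> A. b - 1 / 2 < r}"
  obtain r0 where r0: "r0 \<in> A" "b - 1/2 < r0"
    using less_cSupD[of A "b - 1/2"] A by (auto simp: b_def)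
  have "infinite A'"
  proof
    assume fA: "finite A'"
    have M: "Max A' \<in> A'" using fA r0 by (intro Max_in) (auto simp: A'_def)
    have "r \<le> Max A'" if "r \<in> A" for r
      using that fA M by (cases "r \<in> A'") (auto simp: A'_def)
    moreover obtain y where "y \<in> S" "\<alpha> y = ereal (Max A')" using M by (auto simp: A'_def A_def)
    ultimately show False using no that[of y] fin unfolding A_def by (metis (mono_tags) ereal_less_eq(3) mem_Collect_eq)
  qed
  then obtain A2 where A2: "finite A2" "card A2 = Suc n" "A2 \<subseteq> A'"
    using infinite_arbitrarily_large by blast
  have "\<exists>g. \<forall>r\<in>A2. g r \<in> S \<and> \<alpha> (g r) = ereal r"
    using A2 by (intro bchoice) (auto simp: A'_def A_def)
  then obtain g where g: "\<And>r. r \<in> A2 \<Longrightarrow> g r \<in> S \<and> \<alpha> (g r) = ereal r" by blast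
  have inj: "inj_on g A2" using g by (metis ereal.inject inj_onI)
  have "independent (g ` A2)"
  proof (rule independent_if_close_norms[OF N, of _ b])
    show "inj_on \<alpha> (g ` A2)" using g by (auto simp: inj_on_def)
    fix x assume "x \<in> g ` A2"
    then obtain r where r: "r \<in> A2" "x = g r" by blast
    then have "r \<in> A" "b - 1/2 < r" using A2 by (auto simp: A'_def)
    then show "ereal (b - 1 / 2) < \<alpha> x \<and> \<alpha> x \<le> ereal b"
      using g[OF r(1)] r A cSup_upper[of r A] by (auto simp: b_def)
  qed (use A2 in simp)
  then show False using independent_card_le[of "g ` A2"] card_image[OF inj] A2 by simp
qed

section \<open>Maxi-minorant norms\<close>

text \<open>One inequality suffices for homogeneity, since the other follows by applying it to the
  inverse scalar. The strict thresholds in the premises suit norms defined as suprema, where a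
  strict bound yields a witness.\<close>

lemma norm_onI:
  assumes minf: "\<And>x. \<alpha> x \<noteq> -\<infinity>" and zero: "\<alpha> 0 = \<infinity>" and inf: "\<And>x. \<alpha> x = \<infinity> \<Longrightarrow> x = 0"
    and add: "\<And>r x y. ereal r < \<alpha> x \<Longrightarrow> ereal r < \<alpha> y \<Longrightarrow> ereal r \<le> \<alpha> (x + y)"
    and scale: "\<And>a w r x. \<omega> a = ereal w \<Longrightarrow> ereal r < \<alpha> x \<Longrightarrow> ereal (w + r) \<le> \<alpha> (s a x)"
  shows "norm_on \<omega> s UNIV \<alpha>"
proof -
  have le: "\<omega> a + \<alpha> x \<le> \<alpha> (s a x)" if w: "\<omega> a = ereal w" for a w x
  proof (rule ereal_le_by_reals)
    fix r assume r: "ereal r < \<omega> a + \<alpha> x"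
    have "ereal (r - w) < \<alpha> x" using r w by (cases "\<alpha> x") auto
    from scale[OF w this] show "ereal r \<le> \<alpha> (s a x)" by simp
  qed
  have "\<alpha> (s a x) = \<omega> a + \<alpha> x" for a x
  proof (cases "a = 0")
    case False
    obtain w where w: "\<omega> a = ereal w" using val_finite False by blast
    have "\<omega> (inverse a) + \<alpha> (s a x) \<le> \<alpha> x"
      using le[OF val_inverse[OF w], of "s a x"] False by simp
    then have "\<alpha> (s a x) \<le> \<omega> a + \<alpha> x"
      unfolding val_inverse[OF w] w by (cases "\<alpha> (s a x)"; cases "\<alpha> x") auto
    then show ?thesis using le[OF w] by (intro antisym)
  qed (simp add: zero)
  moreover have "min (\<alpha> x) (\<alpha> y) \<le> \<alpha> (x + y)" for x y
    by (rule ereal_le_by_reals) (simp add: add)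
  ultimately show ?thesis unfolding norm_on_def using minf zero inf by blast
qed

text \<open>The kernel of the trace is \<open>F_sigma \<sigma>\<close>, because an element of trace
  0 is half the difference of itself and its conjugate. The quadratic condition thereby becomes one
  on elements of trace \<open>h x x\<close>.\<close>

lemma q_bar_eq: "q_bar \<sigma> h x = {l. l + \<sigma> l = h x x}"
proof -
  have hh: "\<sigma> (h x x) = h x x" using h_swap[of x x] by simp
  have "l \<in> q_bar \<sigma> h x" if "l + \<sigma> l = h x x" for l
  proof -
    have "l = h x x / 2 + (l / 2 - \<sigma> (l / 2))" using that[symmetric] by (simp add: field_simps)
    then show ?thesis unfolding q_bar_def F_sigma_def by blast
  qed
  moreover have "l + \<sigma> l = h x x" if "l \<in> q_bar \<sigma> h x" for l
    using that hh by (auto simp: q_bar_def F_sigma_def conj_add conj_diff)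
  ultimately show ?thesis by blast
qed

text \<open>The supremum in \<open>omega_bar\<close> is attained: if \<open>h x x\<close> is
  non-zero, its value bounds that of every element of this trace, and otherwise the element 0 has
  value \<infinity>.\<close>

lemma omega_bar_ge:
  "ereal r \<le> omega_bar \<omega> (q_bar \<sigma> h x) / 2 \<longleftrightarrow> (\<exists>l. l + \<sigma> l = h x x \<and> ereal (2 * r) \<le> \<omega> l)"
proof
  assume r: "ereal r \<le> omega_bar \<omega> (q_bar \<sigma> h x) / 2"
  show "\<exists>l. l + \<sigma> l = h x x \<and> ereal (2 * r) \<le> \<omega> l"
  proof (cases "h x x = 0")
    case True
    then show ?thesis by (intro exI[of _ 0]) simp
  next
    case False
    let ?T = "{l. l + \<sigma> l = h x x}"
    obtain b where b: "\<omega> (h x x) = ereal b" using val_finite[OF False] .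
    have "\<omega> l \<le> ereal b" if "l \<in> ?T" for l
      using val_add[of "\<omega> l" l "\<sigma> l"] that b by simp
    moreover have "h x x / 2 \<in> ?T" using h_swap[of x x] by simp
    ultimately obtain l where l: "l \<in> ?T" "\<And>y. y \<in> ?T \<Longrightarrow> \<omega> y \<le> \<omega> l"
      using val_max_attained[of ?T b] by (metis (no_types, lifting) empty_iff)
    have "omega_bar \<omega> ?T \<le> \<omega> l" unfolding omega_bar_def by (rule SUP_least) (rule l(2))
    then have "ereal (2 * r) \<le> \<omega> l" using r unfolding ereal_le_half_iff q_bar_eq by (rule order_trans[rotated])
    then show ?thesis using l(1) by blast
  qed
next
  assume "\<exists>l. l + \<sigma> l = h x x \<and> ereal (2 * r) \<le> \<omega> l"
  then obtain l where l: "l + \<sigma> l = h x x" "ereal (2 * r) \<le> \<omega> l" by blast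
  have "\<omega> l \<le> omega_bar \<omega> (q_bar \<sigma> h x)"
    unfolding omega_bar_def q_bar_eq by (rule SUP_upper) (simp add: l)
  then show "ereal r \<le> omega_bar \<omega> (q_bar \<sigma> h x) / 2"
    unfolding ereal_le_half_iff using l(2) by (rule order_trans[rotated])
qed

lemma minorizesI:
  assumes N: "norm_on \<omega> s UNIV \<alpha>"
    and pair: "\<And>x y r t. ereal r < \<alpha> x \<Longrightarrow> ereal t < \<alpha> y \<Longrightarrow> ereal (r + t) \<le> \<omega> (h x y)"
    and quad: "\<And>x r. ereal r < \<alpha> x \<Longrightarrow> \<exists>l. l + \<sigma> l = h x x \<and> ereal (2 * r) \<le> \<omega> l"
  shows "minorizes \<sigma> \<omega> h \<alpha>"
proof -
  have minf: "\<alpha> x \<noteq> -\<infinity>" for x using N by (simp add: norm_on_def)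
  have "\<alpha> x + \<alpha> y \<le> \<omega> (h x y)" for x y
  proof (rule ereal_le_by_reals)
    fix q assume q: "ereal q < \<alpha> x + \<alpha> y"
    \<comment> \<open>A threshold below the sum splits into thresholds below the summands. If both
      values are finite, each gives up half of the slack; an infinite one absorbs whatever is
      missing.\<close>
    have "\<exists>r t. ereal r < \<alpha> x \<and> ereal t < \<alpha> y \<and> q = r + t"
    proof (cases "\<alpha> x"; cases "\<alpha> y")
      fix a b assume ab: "\<alpha> x = ereal a" "\<alpha> y = ereal b"
      then show ?thesis using q
        by (intro exI[of _ "a - (a + b - q) / 2"] exI[of _ "b - (a + b - q) / 2"]) (auto simp: field_simps)
    next
      fix a assume "\<alpha> x = ereal a" "\<alpha> y = \<infinity>"
      then show ?thesis by (intro exI[of _ "a - 1"] exI[of _ "q - a + 1"]) auto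
    next
      fix b assume "\<alpha> x = \<infinity>" "\<alpha> y = ereal b"
      then show ?thesis by (intro exI[of _ "q - b + 1"] exI[of _ "b - 1"]) auto
    next
      assume "\<alpha> x = \<infinity>" "\<alpha> y = \<infinity>"
      then show ?thesis by (intro exI[of _ q] exI[of _ 0]) auto
    qed (use minf in auto)
    then show "ereal q \<le> \<omega> (h x y)" using pair by blast
  qed
  moreover have "\<alpha> x \<le> omega_bar \<omega> (q_bar \<sigma> h x) / 2" for x
    by (rule ereal_le_by_reals, rule iffD2[OF omega_bar_ge], rule quad)
  ultimately show ?thesis unfolding minorizes_def by blast
qed

lemma minorizes_pair:
  assumes "minorizes \<sigma> \<omega> h \<alpha>" "ereal r \<le> \<alpha> x" "ereal t \<le> \<alpha> y"
  shows "ereal (r + t) \<le> \<omega> (h x y)"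
proof -
  have "ereal r + ereal t \<le> \<alpha> x + \<alpha> y" using assms(2,3) by (rule add_mono)
  then show ?thesis using assms(1) order_trans unfolding minorizes_def by fastforce
qed

lemma minorizes_quad:
  assumes "minorizes \<sigma> \<omega> h \<alpha>" "ereal r \<le> \<alpha> x"
  obtains l where "l + \<sigma> l = h x x" "ereal (2 * r) \<le> \<omega> l"
  using assms omega_bar_ge[of r x] order_trans unfolding minorizes_def by blast

lemma val_le_delta: "l + \<sigma> l = 1 \<Longrightarrow> \<omega> l \<le> delta_inv \<sigma> \<omega>"
  unfolding delta_inv_def by (rule Sup_upper) blast

lemma h_eq_sum_coords:
  assumes e: "antidiagonal_on h n e"
  shows "h x y = (\<Sum>i\<in>{1..n}. \<sigma> (h (e (n + 1 - i)) x) * h (e i) y)"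
proof -
  have "h x y = h (\<Sum>i\<in>{1..n}. s (h (e (n + 1 - i)) x) (e i)) y"
    using expand[OF e, of x] by simp
  then show ?thesis by (simp add: h_sum_left h_scale_left)
qed

lemma antidiagonal_nonzero:
  assumes e: "antidiagonal_on h n e" and i: "i \<in> {1..n}"
  shows "e i \<noteq> 0"
proof
  assume "e i = 0"
  then have "h (e i) (e (n + 1 - i)) = 0" by simp
  moreover have "n + 1 - i \<in> {1..n}" using i by auto
  ultimately show False using antidiagonalD[OF e i, of "n + 1 - i"] i by auto
qed

section \<open>A criterion for norms to be maxi-minorant\<close>

text \<open>The values at a pair \<open>i\<close>, \<open>n + 1 - i\<close> add up to at most 0,
  which bounds \<open>h x y\<close> term by term. In \<open>h x x\<close> the terms below and above
  the middle are conjugate sums, so only the middle term needs the trace-one element of value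
  \<delta>. Maximality is checked on each coordinate.\<close>

lemma maxi_minorant_if_adapted:
  assumes N: "norm_on \<omega> s UNIV \<beta>" and e: "antidiagonal_on h n e"
    and adapted: "\<And>x i. i \<in> {1..n} \<Longrightarrow> \<beta> x \<le> \<beta> (s (h (e (n + 1 - i)) x) (e i))"
    and dual: "\<And>i. i \<in> {1..n} \<Longrightarrow> i \<noteq> m + 1 \<Longrightarrow> \<beta> (e i) + \<beta> (e (n + 1 - i)) = 0"
    and mid: "\<beta> (e (m + 1)) = delta_inv \<sigma> \<omega> / 2"
  shows "\<beta> \<in> maxi_minorant_norms \<sigma> \<omega> s h"
proof -
  obtain t d where td: "t + \<sigma> t = 1" "\<omega> t = ereal d" "delta_inv \<sigma> \<omega> = ereal d" "d \<le> 0"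
    using delta_attained .
  have "\<exists>c. \<beta> (e i) = ereal c" if "i \<in> {1..n}" for i
    using norm_finite[OF N UNIV_I antidiagonal_nonzero[OF e that]] by blast
  then obtain c where c: "\<And>i. i \<in> {1..n} \<Longrightarrow> \<beta> (e i) = ereal (c i)" by metis
  have inv: "n + 1 - i \<in> {1..n}" "n + 1 - (n + 1 - i) = i" if "i \<in> {1..n}" for i using that by auto
  have m1: "m + 1 \<in> {1..n}" "n + 1 - (m + 1) = m + 1" using odd_dim by auto
  have c_dual: "c i + c (n + 1 - i) = 0" if "i \<in> {1..n}" "i \<noteq> m + 1" for i
    using dual[OF that] c[OF that(1)] c[OF inv(1)[OF that(1)]] by (simp add: zero_ereal_def)
  have c_mid: "c (m + 1) = d / 2" using mid c[OF m1(1)] td(3) by simp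
  \<comment> \<open>The middle index is its own partner and contributes \<open>d\<close>, which is
    at most 0.\<close>
  have c_le: "c i + c (n + 1 - i) \<le> 0" if i: "i \<in> {1..n}" for i
  proof (cases "i = m + 1")
    case True
    then show ?thesis using c_mid td(4) m1(2) by simp
  next
    case False
    then show ?thesis using c_dual[OF i] by simp
  qed
  define X where "X x i = h (e (n + 1 - i)) x" for x i
  have coord: "ereal (r - c i) \<le> \<omega> (X x i)" if r: "ereal r < \<beta> x" and i: "i \<in> {1..n}" for r x i
  proof -
    have "ereal r \<le> \<omega> (X x i) + ereal (c i)"
      using less_le_trans[OF r adapted[OF i]] norm_scale[OF N UNIV_I] c[OF i] by (simp add: X_def less_imp_le)
    then show ?thesis by (cases "\<omega> (X x i)") auto
  qed
  have h_eq: "h x y = (\<Sum>i\<in>{1..n}. \<sigma> (X x i) * X y (n + 1 - i))" for x y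
    unfolding h_eq_sum_coords[OF e, of x y] X_def by (rule sum.cong) (use inv in auto)
  have prod_bound: "ereal (r + r') \<le> \<omega> (\<sigma> (X x i) * X y (n + 1 - i))"
    if r: "ereal r < \<beta> x" "ereal r' < \<beta> y" and i: "i \<in> {1..n}" for r r' x y i
  proof -
    have "ereal (r - c i) + ereal (r' - c (n + 1 - i)) \<le> \<omega> (\<sigma> (X x i)) + \<omega> (X y (n + 1 - i))"
      using coord[OF r(1) i] coord[OF r(2) inv(1)[OF i]] by (intro add_mono) simp_all
    moreover have "ereal (r + r') \<le> ereal (r - c i) + ereal (r' - c (n + 1 - i))"
      using c_le[OF i] by simp
    ultimately show ?thesis unfolding val_mult by (rule order_trans[rotated])
  qed
  have min: "minorizes \<sigma> \<omega> h \<beta>"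
  proof (rule minorizesI[OF N])
    show "ereal (r + r') \<le> \<omega> (h x y)" if "ereal r < \<beta> x" "ereal r' < \<beta> y" for x y r r'
      unfolding h_eq by (rule val_sum) (rule prod_bound[OF that])
  next
    fix x r assume r: "ereal r < \<beta> x"
    define A where "A = (\<Sum>i\<in>{1..m}. \<sigma> (X x i) * X x (n + 1 - i))"
    define B where "B = \<sigma> (X x (m + 1)) * X x (m + 1)"
    have split3: "{1..n} = {1..m} \<union> ({m + 1} \<union> {m + 2..n})" using odd_dim by auto
    have "h x x = A + (B + (\<Sum>i\<in>{m + 2..n}. \<sigma> (X x i) * X x (n + 1 - i)))"
      unfolding h_eq split3 A_def B_def
      by (subst sum.union_disjoint, simp, simp, force, subst sum.union_disjoint) (use m1(2) in auto)
    also have "(\<Sum>i\<in>{m + 2..n}. \<sigma> (X x i) * X x (n + 1 - i)) = (\<Sum>i\<in>{1..m}. \<sigma> (X x (n + 1 - i)) * X x i)"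
      by (rule sum.reindex_bij_witness[of _ "\<lambda>i. n + 1 - i" "\<lambda>i. n + 1 - i"]) (use odd_dim in auto)
    also have "\<dots> = \<sigma> A"
    proof -
      have "\<sigma> (sum g I) = (\<Sum>i\<in>I. \<sigma> (g i))" for g :: "nat \<Rightarrow> 'f" and I
        by (induction I rule: infinite_finite_induct) (auto simp: conj_add)
      then show ?thesis unfolding A_def by (simp add: conj_mult mult.commute)
    qed
    finally have hx: "h x x = A + (B + \<sigma> A)" .
    \<comment> \<open>\<open>B\<close> is fixed by \<sigma> and \<open>t\<close> has trace 1, so
      \<open>B * t\<close> has trace \<open>B\<close>. The factor \<open>t\<close> adds
      \<open>d\<close> to the value, which compensates the loss of \<open>d / 2\<close> in each of
      the two middle coordinates.\<close>
    define l where "l = A + B * t"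
    have "\<sigma> B = B" unfolding B_def by (simp add: conj_mult mult.commute)
    then have "l + \<sigma> l = A + (B * (t + \<sigma> t) + \<sigma> A)"
      unfolding l_def by (simp add: conj_add conj_mult algebra_simps)
    then have "l + \<sigma> l = h x x" using hx td(1) by simp
    moreover have "ereal (2 * r) \<le> \<omega> l"
      unfolding l_def
    proof (rule val_add)
      have "ereal (r + r) \<le> \<omega> A"
        unfolding A_def using prod_bound[OF r r] odd_dim by (intro val_sum) auto
      then show "ereal (2 * r) \<le> \<omega> A" by simp
      have le: "ereal (r - d / 2) \<le> \<omega> (X x (m + 1))"
        using coord[OF r m1(1)] unfolding c_mid .
      then have "ereal (r - d / 2) \<le> \<omega> (\<sigma> (X x (m + 1)))" by simp
      from add_mono[OF add_mono[OF this le] order_refl[of "\<omega> t"]]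
      show "ereal (2 * r) \<le> \<omega> (B * t)" unfolding B_def val_mult td(2) by simp
    qed
    ultimately show "\<exists>l. l + \<sigma> l = h x x \<and> ereal (2 * r) \<le> \<omega> l" by blast
  qed
  have "\<gamma> = \<beta>" if G: "norm_on \<omega> s UNIV \<gamma>" "minorizes \<sigma> \<omega> h \<gamma>" "\<And>x. \<beta> x \<le> \<gamma> x" for \<gamma>
  proof (rule ext, rule antisym[OF _ G(3)], rule ereal_le_by_reals)
    fix x r assume "ereal r < \<gamma> x"
    then have r: "ereal r \<le> \<gamma> x" by simp
    have off: "ereal r \<le> \<beta> (s (X x i) (e i))" if i: "i \<in> {1..n}" "i \<noteq> m + 1" for i
    proof -
      have "ereal (c (n + 1 - i)) \<le> \<gamma> (e (n + 1 - i))"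
        using G(3)[of "e (n + 1 - i)"] c[OF inv(1)[OF i(1)]] by simp
      from minorizes_pair[OF G(2) this r] have "ereal (c (n + 1 - i) + r) \<le> \<omega> (X x i)" by (simp add: X_def)
      from add_mono[OF this order_refl[of "ereal (c i)"]] show ?thesis
        using norm_scale[OF N UNIV_I] c[OF i(1)] c_dual[OF i] by (simp add: algebra_simps)
    qed
    \<comment> \<open>Off the middle, duality already bounds the components of \<open>x\<close> for
      \<beta>, hence for \<gamma>. Subtracting them shows that \<gamma> is at least \<open>r\<close>
      on the middle component too.\<close>
    define y where "y = (\<Sum>i\<in>{1..n} - {m + 1}. s (X x i) (e i))"
    have xy: "x = s (X x (m + 1)) (e (m + 1)) + y"
      using expand[OF e, of x] sum.remove[of "{1..n}" "m + 1" "\<lambda>i. s (X x i) (e i)"] m1(1)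
      by (simp add: y_def X_def)
    have "ereal r \<le> \<gamma> y"
      unfolding y_def using off by (intro norm_ge_sum[OF G(1)] order_trans[OF off G(3)]) auto
    from norm_ge_diff[OF G(1) r this] have r0: "ereal r \<le> \<gamma> (s (X x (m + 1)) (e (m + 1)))"
      using xy by (metis add_diff_cancel_right')
    have middle: "ereal r \<le> \<beta> (s (X x (m + 1)) (e (m + 1)))"
    proof (cases "X x (m + 1) = 0")
      case True
      then show ?thesis using norm_zero[OF N UNIV_I] by simp
    next
      case False
      then obtain w where w: "\<omega> (X x (m + 1)) = ereal w" using val_finite by blast
      have "ereal (r - w) \<le> \<gamma> (e (m + 1))"
        using r0 w norm_scale[OF G(1) UNIV_I] by (cases "\<gamma> (e (m + 1))") auto
      then obtain l where l: "l + \<sigma> l = h (e (m + 1)) (e (m + 1))" "ereal (2 * (r - w)) \<le> \<omega> l"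
        using minorizes_quad[OF G(2)] by blast
      have "l + \<sigma> l = 1" using l(1) antidiagonalD[OF e m1(1) m1(1)] m1(2) by simp
      then have "ereal (2 * (r - w)) \<le> ereal d" using l(2) val_le_delta td(3) order_trans by metis
      then show ?thesis using norm_scale[OF N UNIV_I] w c[OF m1(1)] c_mid by simp
    qed
    have "ereal r \<le> \<beta> y" unfolding y_def using off by (intro norm_ge_sum[OF N]) auto
    from norm_ge_add[OF N middle this] show "ereal r \<le> \<beta> x" using xy by simp
  qed
  then show ?thesis unfolding maxi_minorant_norms_def using N min by blast
qed

text \<open>Enlarging \<open>\<alpha>\<close> by forcing the value \<open>\<rho>\<close> at \<open>u\<close> keeps it a minorant.\<close>
lemma maxi_minorant_isotropic:
  assumes \<alpha>: "\<alpha> \<in> maxi_minorant_norms \<sigma> \<omega> s h" and u: "h u u = 0"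
    and bound: "\<And>x r. ereal r \<le> \<alpha> x \<Longrightarrow> ereal (\<rho> + r) \<le> \<omega> (h u x)"
  shows "ereal \<rho> \<le> \<alpha> u"
proof -
  have N: "norm_on \<omega> s UNIV \<alpha>" and M: "minorizes \<sigma> \<omega> h \<alpha>"
    and max: "\<And>\<beta>. norm_on \<omega> s UNIV \<beta> \<Longrightarrow> minorizes \<sigma> \<omega> h \<beta> \<Longrightarrow> (\<And>x. \<alpha> x \<le> \<beta> x) \<Longrightarrow> \<beta> = \<alpha>"
    using \<alpha> unfolding maxi_minorant_norms_def by blast+
  \<comment> \<open>This is the image, under addition, of the direct sum of \<alpha> and the norm
    with value \<rho> at \<open>u\<close> on the line of \<open>u\<close>: the supremum runs over
    all ways to split off a multiple of \<open>u\<close>.\<close>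
  define \<beta> where "\<beta> x = (SUP l. min (\<alpha> (x - s l u)) (\<omega> l + ereal \<rho>))" for x
  have \<beta>_ge: "ereal r \<le> \<beta> x" if "ereal r \<le> \<alpha> (x - s l u)" "ereal (r - \<rho>) \<le> \<omega> l" for r x l
  proof -
    have "ereal r \<le> \<omega> l + ereal \<rho>" using that(2) by (cases "\<omega> l") auto
    then show ?thesis unfolding \<beta>_def using that(1) by (intro SUP_upper2[of l]) auto
  qed
  have \<beta>_less: "\<exists>l. ereal r \<le> \<alpha> (x - s l u) \<and> ereal (r - \<rho>) \<le> \<omega> l" if r: "ereal r < \<beta> x" for r x
  proof -
    obtain l where "ereal r < min (\<alpha> (x - s l u)) (\<omega> l + ereal \<rho>)"
      using r unfolding \<beta>_def less_SUP_iff by blast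
    then have "ereal r \<le> \<alpha> (x - s l u)" "ereal (r - \<rho>) \<le> \<omega> l"
      by (auto simp: less_imp_le) (cases "\<omega> l"; auto)
    then show ?thesis by blast
  qed
  have \<alpha>\<beta>: "\<alpha> x \<le> \<beta> x" for x
    by (rule ereal_le_by_reals, rule \<beta>_ge[of _ _ 0]) simp_all
  have pair: "ereal (r + t) \<le> \<omega> (h x y)" if r: "ereal r < \<beta> x" and t: "ereal t < \<beta> y" for r t x y
  proof -
    obtain l where l: "ereal r \<le> \<alpha> (x - s l u)" "ereal (r - \<rho>) \<le> \<omega> l" using \<beta>_less[OF r] by blast
    obtain k where k: "ereal t \<le> \<alpha> (y - s k u)" "ereal (t - \<rho>) \<le> \<omega> k" using \<beta>_less[OF t] by blast
    \<comment> \<open>As \<open>u\<close> is isotropic, the term in \<open>l\<close> and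
      \<open>k\<close> together vanishes. The two mixed terms are controlled by
      \<open>bound\<close>.\<close>
    have "h x y = h ((x - s l u) + s l u) ((y - s k u) + s k u)" by simp
    also have "\<dots> = h (x - s l u) (y - s k u) + (k * \<sigma> (h u (x - s l u)) + \<sigma> l * h u (y - s k u))"
      unfolding h_add_left h_add_right h_scale_left h_scale_right u h_swap[of "x - s l u" u, symmetric]
      by (simp add: algebra_simps)
    finally have eq: "h x y = h (x - s l u) (y - s k u) + (k * \<sigma> (h u (x - s l u)) + \<sigma> l * h u (y - s k u))" .
    have "ereal (t - \<rho>) + ereal (\<rho> + r) \<le> \<omega> (k * \<sigma> (h u (x - s l u)))"
      unfolding val_mult val_conj by (rule add_mono[OF k(2) bound[OF l(1)]])
    moreover have "ereal (r - \<rho>) + ereal (\<rho> + t) \<le> \<omega> (\<sigma> l * h u (y - s k u))"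
      unfolding val_mult val_conj by (rule add_mono[OF l(2) bound[OF k(1)]])
    ultimately show ?thesis
      unfolding eq using minorizes_pair[OF M l(1) k(1)] by (intro val_add) (simp_all add: algebra_simps)
  qed
  have "norm_on \<omega> s UNIV \<beta>"
  proof (rule norm_onI)
    show "\<beta> x \<noteq> -\<infinity>" for x using \<alpha>\<beta>[of x] N by (auto simp: norm_on_def)
    show "\<beta> 0 = \<infinity>" using \<alpha>\<beta>[of 0] norm_zero[OF N UNIV_I] by simp
    \<comment> \<open>By non-degeneracy a non-zero \<open>x\<close> pairs to some finite value
      \<open>w\<close> with a suitable \<open>y\<close>. The pairing inequality with thresholds
      summing to \<open>w + 1\<close> then gives a contradiction.\<close>
    show "x = 0" if inf: "\<beta> x = \<infinity>" for x
    proof (rule ccontr)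
      assume "x \<noteq> 0"
      then obtain y where y: "h x y \<noteq> 0" using nondeg by (auto simp: nondegenerate_def)
      then have "y \<noteq> 0" by auto
      then obtain a where a: "\<alpha> y = ereal a" using norm_finite[OF N UNIV_I] by blast
      obtain w where w: "\<omega> (h x y) = ereal w" using val_finite[OF y] .
      have "ereal (a - 1) < \<beta> y" using \<alpha>\<beta>[of y] a by (metis ereal_less(1) ereal_less_eq(3) less_ereal.simps(1) diff_less_eq less_add_one order_less_le_trans)
      then have "ereal ((w - a + 2) + (a - 1)) \<le> \<omega> (h x y)" using pair[of "w - a + 2" x "a - 1" y] inf by simp
      then show False using w by simp
    qed
    show "ereal r \<le> \<beta> (x + y)" if r: "ereal r < \<beta> x" "ereal r < \<beta> y" for r x y
    proof -
      obtain l where l: "ereal r \<le> \<alpha> (x - s l u)" "ereal (r - \<rho>) \<le> \<omega> l" using \<beta>_less[OF r(1)] by blast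
      obtain k where k: "ereal r \<le> \<alpha> (y - s k u)" "ereal (r - \<rho>) \<le> \<omega> k" using \<beta>_less[OF r(2)] by blast
      have "x + y - s (l + k) u = (x - s l u) + (y - s k u)" by (simp add: scale_left_distrib)
      then have "ereal r \<le> \<alpha> (x + y - s (l + k) u)" using norm_ge_add[OF N l(1) k(1)] by metis
      then show ?thesis using val_add[OF l(2) k(2)] by (rule \<beta>_ge)
    qed
    show "ereal (w + r) \<le> \<beta> (s a x)" if w: "\<omega> a = ereal w" and r: "ereal r < \<beta> x" for a w r x
    proof -
      obtain l where l: "ereal r \<le> \<alpha> (x - s l u)" "ereal (r - \<rho>) \<le> \<omega> l" using \<beta>_less[OF r] by blast
      have "s a x - s (a * l) u = s a (x - s l u)" by (simp add: scale_right_diff_distrib)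
      moreover have "ereal w + ereal (r - \<rho>) \<le> \<omega> (a * l)" unfolding val_mult using w l(2) by (intro add_mono) simp_all
      ultimately show ?thesis
        using norm_ge_scale[OF N UNIV_I l(1), of w a] w by (intro \<beta>_ge[of _ _ "a * l"]) (simp_all add: algebra_simps)
    qed
  qed
  moreover from this have "minorizes \<sigma> \<omega> h \<beta>"
  proof (rule minorizesI)
    show "ereal (r + t) \<le> \<omega> (h x y)" if "ereal r < \<beta> x" "ereal t < \<beta> y" for r t x y
      using pair[OF that] .
    fix x r assume "ereal r < \<beta> x"
    then obtain l where l: "ereal r \<le> \<alpha> (x - s l u)" "ereal (r - \<rho>) \<le> \<omega> l" using \<beta>_less by blast
    obtain k where k: "k + \<sigma> k = h (x - s l u) (x - s l u)" "ereal (2 * r) \<le> \<omega> k"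
      using minorizes_quad[OF M l(1)] .
    \<comment> \<open>Since \<open>u\<close> is isotropic, moving by a multiple of it changes
      \<open>h x x\<close> by the trace of \<open>?z\<close>, so \<open>k + ?z\<close> has the
      required trace.\<close>
    let ?z = "\<sigma> l * h u (x - s l u)"
    have "h x x = h ((x - s l u) + s l u) ((x - s l u) + s l u)" by simp
    also have "\<dots> = h (x - s l u) (x - s l u) + (?z + \<sigma> ?z)"
      unfolding h_add_left h_add_right h_scale_left h_scale_right u conj_mult h_swap[of "x - s l u" u, symmetric]
      by (simp add: algebra_simps)
    finally have "(k + ?z) + \<sigma> (k + ?z) = h x x" using k(1) by (simp add: conj_add algebra_simps)
    moreover have "ereal (r - \<rho>) + ereal (\<rho> + r) \<le> \<omega> ?z"
      unfolding val_mult val_conj by (rule add_mono[OF l(2) bound[OF l(1)]])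
    then have "ereal (2 * r) \<le> \<omega> (k + ?z)" using k(2) by (intro val_add) simp_all
    ultimately show "\<exists>l. l + \<sigma> l = h x x \<and> ereal (2 * r) \<le> \<omega> l" by blast
  qed
  ultimately have "\<beta> = \<alpha>" using max \<alpha>\<beta> by blast
  moreover have "ereal \<rho> \<le> \<beta> u"
    by (rule \<beta>_ge[of _ _ 1]) (simp_all add: norm_zero[OF N] zero_ereal_def[symmetric])
  ultimately show ?thesis by simp
qed

section \<open>Witt bases adapted to a maxi-minorant norm\<close>

text \<open>The value of \<open>h v x\<close> is at least \<open>\<alpha> v + \<alpha> x\<close>,
  and the term \<open>\<alpha> v\<close> cancels against \<open>\<alpha> u\<close>. Taking
  components along a dual pair therefore never lowers the norm, which is what splits off hyperbolic
  planes.\<close>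

lemma norm_coord_ge:
  assumes N: "norm_on \<omega> s UNIV \<alpha>" and M: "minorizes \<sigma> \<omega> h \<alpha>"
    and dual: "\<alpha> u + \<alpha> v = 0"
  shows "\<alpha> x \<le> \<alpha> (s (h v x) u)"
proof (rule ereal_le_by_reals)
  fix r assume r: "ereal r < \<alpha> x"
  have "\<alpha> u \<noteq> -\<infinity>" "\<alpha> v \<noteq> -\<infinity>" using N by (simp_all add: norm_on_def)
  then obtain a b where ab: "\<alpha> u = ereal a" "\<alpha> v = ereal b" "a + b = 0"
    using dual by (cases "\<alpha> u"; cases "\<alpha> v") (auto simp: zero_ereal_def)
  have "ereal (b + r) \<le> \<omega> (h v x)" using minorizes_pair[OF M, of b v r x] ab r by simp
  from norm_ge_scale[OF N UNIV_I _ this, of a u] have "ereal (b + r + a) \<le> \<alpha> (s (h v x) u)"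
    using ab by simp
  moreover have "b + r + a = r" using ab(3) by simp
  ultimately show "ereal r \<le> \<alpha> (s (h v x) u)" by simp
qed

text \<open>Let \<open>r\<close> be the largest norm on the affine hyperplane
  \<open>h u y = 1\<close>, attained by discreteness. Then \<open>- r\<close> is an admissible value
  to force at the isotropic vector \<open>u\<close>, so maximality gives
  \<open>- r \<le> \<alpha> u\<close>; minorization gives the other inequality.\<close>

lemma hyperbolic_partner:
  assumes \<alpha>: "\<alpha> \<in> maxi_minorant_norms \<sigma> \<omega> s h" and u: "u \<noteq> 0" "h u u = 0"
  obtains y r where "h u y = 1" "\<alpha> u = ereal (- r)" "\<alpha> y = ereal r"
proof -
  have N: "norm_on \<omega> s UNIV \<alpha>" and M: "minorizes \<sigma> \<omega> h \<alpha>"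
    using \<alpha> unfolding maxi_minorant_norms_def by blast+
  obtain a where a: "\<alpha> u = ereal a" using norm_finite[OF N UNIV_I u(1)] .
  have normalize: "h u (s (inverse (h u x)) x) = 1" if "h u x \<noteq> 0" for x
    using that by (simp add: h_scale_right)
  obtain x where x: "h u x \<noteq> 0" using u(1) nondeg by (auto simp: nondegenerate_def)
  have bd: "\<alpha> y \<le> ereal (- a)" if "y \<in> {y. h u y = 1}" for y
  proof (rule ereal_le_by_reals)
    fix q assume "ereal q < \<alpha> y"
    then have "ereal (a + q) \<le> \<omega> (h u y)" using minorizes_pair[OF M, of a u q y] a by simp
    then show "ereal q \<le> ereal (- a)" using that by (simp add: zero_ereal_def)
  qed
  have "{y. h u y = 1} \<noteq> {}" using normalize[OF x] by blast
  from norm_max_attained[OF N this bd]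
  obtain y where y: "h u y = 1" "\<And>z. h u z = 1 \<Longrightarrow> \<alpha> z \<le> \<alpha> y" by auto
  have "y \<noteq> 0" using y(1) by auto
  then obtain r where r: "\<alpha> y = ereal r" using norm_finite[OF N UNIV_I] by blast
  have "ereal (- r) \<le> \<alpha> u"
  proof (rule maxi_minorant_isotropic[OF \<alpha> u(2)])
    fix x t assume t: "ereal t \<le> \<alpha> x"
    show "ereal (- r + t) \<le> \<omega> (h u x)"
    proof (cases "h u x = 0")
      case False
      obtain w where w: "\<omega> (h u x) = ereal w" using val_finite[OF False] .
      \<comment> \<open>Rescaling moves \<open>x\<close> into the hyperplane, where the norm is at
        most \<open>r\<close>.\<close>
      have "ereal (- w + t) \<le> \<alpha> (s (inverse (h u x)) x)"
        using val_inverse[OF w] by (intro norm_ge_scale[OF N UNIV_I t]) simp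
      also have "\<dots> \<le> ereal r" using y(2)[OF normalize[OF False]] r by simp
      finally show ?thesis using w by simp
    qed simp
  qed
  then have "- r = a" using bd[of y] y(1) r a by simp
  then show thesis using that y(1) r a by blast
qed

text \<open>With \<open>k\<close> pairs already dual, the next isotropic vector
  \<open>e (k + 1)\<close> gets a partner that is made orthogonal to the earlier planes and then
  isotropic, at no cost in norm. The other basis vectors are corrected by multiples of
  \<open>e (k + 1)\<close> to restore the Gram matrix.\<close>

lemma witt_step:
  assumes \<alpha>: "\<alpha> \<in> maxi_minorant_norms \<sigma> \<omega> s h" and e: "antidiagonal_on h n e" and k: "k < m"
    and dual: "\<And>i. i \<in> {1..k} \<Longrightarrow> \<alpha> (e i) + \<alpha> (e (n + 1 - i)) = 0"
  obtains f where "antidiagonal_on h n f" "\<And>i. i \<in> {1..k + 1} \<Longrightarrow> \<alpha> (f i) + \<alpha> (f (n + 1 - i)) = 0"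
proof -
  have N: "norm_on \<omega> s UNIV \<alpha>" and M: "minorizes \<sigma> \<omega> h \<alpha>"
    using \<alpha> unfolding maxi_minorant_norms_def by blast+
  define u where "u = e (k + 1)"
  \<comment> \<open>Indices of the planes already split off; the set is empty for
    \<open>k = 0\<close>.\<close>
  define J where "J = {1..k} \<union> {n + 1 - k..n}"
  have kn: "k + 1 \<in> {1..n}" "n - k \<in> {1..n}" "n + 1 - (k + 1) = n - k" "n + 1 - (n - k) = k + 1"
    "n - k \<noteq> k + 1" "k + 1 \<notin> J" "n - k \<notin> J"
    using k odd_dim by (auto simp: J_def)
  have J: "J \<subseteq> {1..n}" "finite J" using k odd_dim by (auto simp: J_def)
  have u_e: "h u (e i) = (if i = n - k then 1 else 0)" "h (e i) u = (if i = n - k then 1 else 0)"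
    if "i \<in> {1..n}" for i
  proof -
    show "h u (e i) = (if i = n - k then 1 else 0)"
      unfolding u_def antidiagonalD[OF e kn(1) that] using that k odd_dim by auto
    show "h (e i) u = (if i = n - k then 1 else 0)"
      unfolding u_def antidiagonalD[OF e that kn(1)] using kn(3) by simp
  qed
  have uu: "h u u = 0" using u_e(1)[OF kn(1)] kn(5) by (simp add: u_def)
  have u0: "u \<noteq> 0" unfolding u_def by (rule antidiagonal_nonzero[OF e kn(1)])
  obtain y0 r where y0: "h u y0 = 1" and r: "\<alpha> u = ereal (- r)" "\<alpha> y0 = ereal r"
    using hyperbolic_partner[OF \<alpha> u0 uu] .
  \<comment> \<open>The projection of \<open>y0\<close> to the planes already split off. Its norm is
    at least that of \<open>y0\<close> because those pairs are dual, so removing it keeps the norm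
    at least \<open>r\<close>.\<close>
  define p where "p = (\<Sum>i\<in>J. s (h (e (n + 1 - i)) y0) (e i))"
  define y where "y = y0 - p"
  have dualJ: "\<alpha> (e i) + \<alpha> (e (n + 1 - i)) = 0" if "i \<in> J" for i
  proof (cases "i \<in> {1..k}")
    case False
    then have "n + 1 - i \<in> {1..k}" "n + 1 - (n + 1 - i) = i" using that k odd_dim by (auto simp: J_def)
    then show ?thesis using dual[of "n + 1 - i"] by (simp add: add.commute)
  qed (rule dual)
  have "ereal r \<le> \<alpha> p"
    unfolding p_def using norm_coord_ge[OF N M dualJ, of _ y0] r(2) by (intro norm_ge_sum[OF N]) simp
  then have \<alpha>y: "ereal r \<le> \<alpha> y" unfolding y_def using r(2) by (intro norm_ge_diff[OF N]) simp_all
  have ey: "h (e i) y = 0" if "i \<in> J" for i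
  proof -
    have i: "n + 1 - i \<in> J" "n + 1 - i \<in> {1..n}" "n + 1 - (n + 1 - i) = i"
      using that k odd_dim by (auto simp: J_def)
    from antidiagonal_coord[OF e J(1) i(2), of "\<lambda>i. h (e (n + 1 - i)) y0"]
    show ?thesis using i unfolding y_def p_def h_diff_right by simp
  qed
  have "h u p = 0"
    using antidiagonal_coord[OF e J(1) kn(2), of "\<lambda>i. h (e (n + 1 - i)) y0"] kn(4,7)
    unfolding u_def p_def by simp
  then have uy: "h u y = 1" unfolding y_def h_diff_right using y0 by simp
  then have yu: "h y u = 1" using h_swap[of y u] by simp
  obtain l where l: "l + \<sigma> l = h y y" "ereal (2 * r) \<le> \<omega> l" using minorizes_quad[OF M \<alpha>y] .
  \<comment> \<open>\<open>v\<close> is isotropic by the trace condition on \<open>l\<close>, and \<open>\<omega> l \<ge> 2 * r\<close> keeps its norm at least \<open>r\<close>.\<close>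
  define v where "v = y - s l u"
  have uv: "h u v = 1" unfolding v_def h_diff_right h_scale_right using uy uu by simp
  have vu: "h v u = 1" using h_swap[of v u] uv by simp
  have "h v v = h y y - (l + \<sigma> l)"
    unfolding v_def h_diff_right h_diff_left h_scale_right h_scale_left uy yu uu by simp
  then have vv: "h v v = 0" using l(1) by simp
  have ve: "h v (e i) = 0" if "i \<in> J" for i
  proof -
    have i: "i \<in> {1..n}" "i \<noteq> n - k" using that J(1) kn(7) by auto
    have "h (e i) v = 0" unfolding v_def h_diff_right h_scale_right using ey[OF that] u_e(2)[OF i(1)] i(2) by simp
    then show ?thesis using h_swap[of v "e i"] by simp
  qed
  have "ereal (2 * r + - r) \<le> \<alpha> (s l u)" by (rule norm_ge_scale[OF N UNIV_I _ l(2)]) (simp add: r)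
  then have \<alpha>v: "ereal r \<le> \<alpha> v" unfolding v_def using \<alpha>y by (intro norm_ge_diff[OF N]) simp_all
  \<comment> \<open>Minorization with \<open>h u v = 1\<close> supplies the upper bound, and
    \<open>\<alpha> u = - r\<close>, \<open>r \<le> \<alpha> v\<close> the lower one.\<close>
  have "\<alpha> u + \<alpha> v \<le> 0" using M uv unfolding minorizes_def by (metis val_one)
  then have uv0: "\<alpha> u + \<alpha> v = 0" using \<alpha>v unfolding r(1) by (cases "\<alpha> v") (auto simp: zero_ereal_def)
  \<comment> \<open>The exception keeps \<open>f (k + 1) = u\<close>: there
    \<open>h v u = 1\<close>, and the correction would annihilate the vector. On \<open>J\<close>
    the coefficient vanishes, so earlier pairs stay unchanged.\<close>
  define a where "a i = (if i = k + 1 then 0 else h v (e i))" for i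
  define f where "f i = (if i = n - k then v else e i - s (a i) u)" for i
  have fv: "h v (f j) = (if j = k + 1 then 1 else 0)" if j: "j \<in> {1..n}" for j
  proof (cases "j = n - k")
    case True
    then show ?thesis using vv kn(5) by (simp add: f_def)
  next
    case False
    then show ?thesis using vu by (auto simp: f_def a_def h_diff_right h_scale_right u_def)
  qed
  have f: "antidiagonal_on h n f"
    unfolding antidiagonal_on_def
  proof (intro ballI)
    fix i j assume ij: "i \<in> {1..n}" "j \<in> {1..n}"
    consider "i = n - k" | "j = n - k" | "i \<noteq> n - k" "j \<noteq> n - k" by blast
    then show "h (f i) (f j) = (if i = n + 1 - j then 1 else 0)"
    proof cases
      case 1
      have "(j = k + 1) = (i = n + 1 - j)" using ij 1 k odd_dim by auto
      then show ?thesis using fv[OF ij(2)] 1 by (simp add: f_def)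
    next
      case 2
      have "(i = k + 1) = (i = n + 1 - j)" using ij 2 k odd_dim by auto
      then show ?thesis using fv[OF ij(1)] 2 h_swap[of "f i" v] by (simp add: f_def)
    next
      case 3
      \<comment> \<open>Among the \<open>e i\<close>, only \<open>e (n - k)\<close> pairs
        non-trivially with \<open>u\<close>, so the corrections do not affect these
        products.\<close>
      have "h (f i) (f j) = h (e i) (e j)"
        using 3 u_e[OF ij(1)] u_e[OF ij(2)] uu
        by (simp add: f_def h_diff_right h_diff_left h_scale_right h_scale_left)
      then show ?thesis using antidiagonalD[OF e ij] by simp
    qed
  qed
  have "\<alpha> (f i) + \<alpha> (f (n + 1 - i)) = 0" if i: "i \<in> {1..k + 1}" for i
  proof (cases "i = k + 1")
    case True
    then show ?thesis using uv0 kn(3,5) by (simp add: f_def a_def u_def)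
  next
    case False
    then have i': "i \<in> {1..k}" "i \<in> J" "n + 1 - i \<in> J" using i k odd_dim by (auto simp: J_def)
    have "f j = e j" if "j \<in> J" for j
      using that kn(6,7) ve[OF that] by (auto simp: f_def a_def)
    then show ?thesis using dual[OF i'(1)] i' by simp
  qed
  with f show thesis using that by blast
qed

text \<open>Starting from a split basis, \<open>m\<close> steps make every pair dual. Indices above
  \<open>m + 1\<close> are partners of those already treated.\<close>

lemma maxi_minorant_witt_basis:
  assumes \<alpha>: "\<alpha> \<in> maxi_minorant_norms \<sigma> \<omega> s h"
  obtains e where "antidiagonal_on h n e"
    "\<And>i. i \<in> {1..n} \<Longrightarrow> i \<noteq> m + 1 \<Longrightarrow> \<alpha> (e i) + \<alpha> (e (n + 1 - i)) = 0"
proof -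
  have "\<exists>e. antidiagonal_on h n e \<and> (\<forall>i\<in>{1..k}. \<alpha> (e i) + \<alpha> (e (n + 1 - i)) = 0)" if "k \<le> m" for k
    using that
  proof (induction k)
    case 0
    then show ?case using split by auto
  next
    case (Suc k)
    then obtain e where e: "antidiagonal_on h n e" "\<And>i. i \<in> {1..k} \<Longrightarrow> \<alpha> (e i) + \<alpha> (e (n + 1 - i)) = 0"
      by auto
    show ?case by (rule witt_step[OF \<alpha> e(1) _ e(2)]) (use Suc.prems in auto)
  qed
  then obtain e where e: "antidiagonal_on h n e" "\<And>i. i \<in> {1..m} \<Longrightarrow> \<alpha> (e i) + \<alpha> (e (n + 1 - i)) = 0"
    by blast
  have "\<alpha> (e i) + \<alpha> (e (n + 1 - i)) = 0" if "i \<in> {1..n}" "i \<noteq> m + 1" for i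
  proof (cases "i \<le> m")
    case False
    then have "n + 1 - i \<in> {1..m}" "n + 1 - (n + 1 - i) = i" using that odd_dim by auto
    then show ?thesis using e(2)[of "n + 1 - i"] by (simp add: add.commute)
  qed (use that e(2) in auto)
  then show thesis by (rule that[OF e(1)])
qed

section \<open>Norms split by an antidiagonal basis\<close>

text \<open>For an antidiagonal \<open>e\<close>, this is the direct sum of the norms on the lines
  of the \<open>e i\<close> with value \<open>c i\<close> at \<open>e i\<close>, since the pairings
  are the coordinates.\<close>

definition basis_norm :: "(nat \<Rightarrow> 'v) \<Rightarrow> (nat \<Rightarrow> real) \<Rightarrow> 'v \<Rightarrow> ereal" where
  "basis_norm e c x = (INF i\<in>{1..n}. \<omega> (h (e (n + 1 - i)) x) + ereal (c i))"

lemma basis_norm_ge: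
  "ereal r \<le> basis_norm e c x \<longleftrightarrow> (\<forall>i\<in>{1..n}. ereal (r - c i) \<le> \<omega> (h (e (n + 1 - i)) x))"
proof -
  have "ereal r \<le> y + ereal b \<longleftrightarrow> ereal (r - b) \<le> y" for y b
    by (cases y) auto
  then show ?thesis unfolding basis_norm_def le_INF_iff by simp
qed

lemma norm_on_basis_norm:
  assumes e: "antidiagonal_on h n e"
  shows "norm_on \<omega> s UNIV (basis_norm e c)"
proof (rule norm_onI)
  fix x
  have "\<exists>b. ereal b \<le> \<omega> z + ereal b'" for z b'
    by (cases "\<omega> z") auto
  then have "\<forall>i. \<exists>b. ereal b \<le> \<omega> (h (e (n + 1 - i)) x) + ereal (c i)" by blast
  then obtain b where b: "\<And>i. ereal (b i) \<le> \<omega> (h (e (n + 1 - i)) x) + ereal (c i)" by metis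
  have "- (\<Sum>i\<in>{1..n}. \<bar>b i\<bar>) \<le> b i" if "i \<in> {1..n}" for i
    using member_le_sum[OF that, of "\<lambda>i. \<bar>b i\<bar>"] by simp
  then have "ereal (- (\<Sum>i\<in>{1..n}. \<bar>b i\<bar>)) \<le> basis_norm e c x"
    unfolding basis_norm_def using b by (intro INF_greatest) (meson ereal_less_eq(3) order_trans)
  then show "basis_norm e c x \<noteq> -\<infinity>" by auto
next
  show "basis_norm e c 0 = \<infinity>" by (rule ereal_top) (simp add: basis_norm_ge)
next
  fix x assume "basis_norm e c x = \<infinity>"
  then have ge: "\<And>r. ereal r \<le> basis_norm e c x" by simp
  have "h (e (n + 1 - i)) x = 0" if "i \<in> {1..n}" for i
  proof -
    have "ereal r \<le> \<omega> (h (e (n + 1 - i)) x)" for r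
      using ge[of "r + c i"] that unfolding basis_norm_ge by force
    then have "\<omega> (h (e (n + 1 - i)) x) = \<infinity>" by (rule ereal_top)
    then show ?thesis using val_eq_infinity by blast
  qed
  then show "x = 0" using expand[OF e, of x] by simp
next
  fix r x y assume "ereal r < basis_norm e c x" "ereal r < basis_norm e c y"
  then have "ereal r \<le> basis_norm e c x" "ereal r \<le> basis_norm e c y" by simp_all
  then show "ereal r \<le> basis_norm e c (x + y)"
    unfolding basis_norm_ge h_add_right using val_add by blast
next
  fix a w r x assume w: "\<omega> a = ereal w" and "ereal r < basis_norm e c x"
  then have "ereal r \<le> basis_norm e c x" by simp
  then show "ereal (w + r) \<le> basis_norm e c (s a x)"
    unfolding basis_norm_ge h_scale_right val_mult
    using add_mono[of "\<omega> a" "\<omega> a"] w by (fastforce simp: algebra_simps)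
qed

lemma basis_norm_basis:
  assumes e: "antidiagonal_on h n e" and i: "i \<in> {1..n}"
  shows "basis_norm e c (e i) = ereal (c i)"
proof -
  have *: "h (e (n + 1 - j)) (e i) = (if j = i then 1 else 0)" if "j \<in> {1..n}" for j
  proof -
    have "n + 1 - j \<in> {1..n}" "n + 1 - j = n + 1 - i \<longleftrightarrow> j = i" using that i by auto
    then show ?thesis using antidiagonalD[OF e _ i] by simp
  qed
  have "basis_norm e c (e i) \<le> ereal (c i)"
    unfolding basis_norm_def using i * by (intro INF_lower2[of i]) auto
  moreover have "ereal (c i) \<le> basis_norm e c (e i)"
    unfolding basis_norm_ge using * by (auto simp: zero_ereal_def)
  ultimately show ?thesis by (rule antisym)
qed

text \<open>Let \<beta> be split by the Witt basis, agree with \<alpha> on the off-middle vectors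
  and take the value \<delta>/2 in the middle. It is a minorant by the criterion and dominates
  \<alpha>, so maximality of \<alpha> gives \<open>\<beta> = \<alpha>\<close>, and \<alpha> inherits
  the splitting.\<close>

lemma maxi_minorant_adapted:
  assumes \<alpha>: "\<alpha> \<in> maxi_minorant_norms \<sigma> \<omega> s h"
  obtains e where "antidiagonal_on h n e"
    "\<And>i. i \<in> {1..n} \<Longrightarrow> i \<noteq> m + 1 \<Longrightarrow> \<alpha> (e i) + \<alpha> (e (n + 1 - i)) = 0"
    "\<alpha> (e (m + 1)) = delta_inv \<sigma> \<omega> / 2"
    "\<And>x i. i \<in> {1..n} \<Longrightarrow> \<alpha> x \<le> \<alpha> (s (h (e (n + 1 - i)) x) (e i))"
proof -
  have N: "norm_on \<omega> s UNIV \<alpha>" and M: "minorizes \<sigma> \<omega> h \<alpha>"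
    and max: "\<And>\<beta>. norm_on \<omega> s UNIV \<beta> \<Longrightarrow> minorizes \<sigma> \<omega> h \<beta> \<Longrightarrow> (\<And>x. \<alpha> x \<le> \<beta> x) \<Longrightarrow> \<beta> = \<alpha>"
    using \<alpha> unfolding maxi_minorant_norms_def by blast+
  obtain e where e: "antidiagonal_on h n e"
    and dual: "\<And>i. i \<in> {1..n} \<Longrightarrow> i \<noteq> m + 1 \<Longrightarrow> \<alpha> (e i) + \<alpha> (e (n + 1 - i)) = 0"
    using maxi_minorant_witt_basis[OF \<alpha>] by blast
  obtain t d where td: "delta_inv \<sigma> \<omega> = ereal d" using delta_attained by metis
  have m1: "m + 1 \<in> {1..n}" "n + 1 - (m + 1) = m + 1" using odd_dim by auto
  have "\<exists>c. \<alpha> (e i) = ereal c" if "i \<in> {1..n}" for i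
    using norm_finite[OF N UNIV_I antidiagonal_nonzero[OF e that]] by blast
  then obtain b where b: "\<And>i. i \<in> {1..n} \<Longrightarrow> \<alpha> (e i) = ereal (b i)" by metis
  define c where "c i = (if i = m + 1 then d / 2 else b i)" for i
  define \<beta> where "\<beta> = basis_norm e c"
  have NB: "norm_on \<omega> s UNIV \<beta>" unfolding \<beta>_def by (rule norm_on_basis_norm[OF e])
  have \<beta>e: "\<beta> (e i) = ereal (c i)" if "i \<in> {1..n}" for i
    unfolding \<beta>_def by (rule basis_norm_basis[OF e that])
  have adapted: "\<beta> x \<le> \<beta> (s (h (e (n + 1 - i)) x) (e i))" if i: "i \<in> {1..n}" for x i
    unfolding norm_scale[OF NB UNIV_I] \<beta>e[OF i] unfolding \<beta>_def basis_norm_def by (rule INF_lower[OF i])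
  have \<beta>mm: "\<beta> \<in> maxi_minorant_norms \<sigma> \<omega> s h"
  proof (rule maxi_minorant_if_adapted[OF NB e adapted])
    fix i assume i: "i \<in> {1..n}" "i \<noteq> m + 1"
    then have "n + 1 - i \<in> {1..n}" "n + 1 - i \<noteq> m + 1" using odd_dim by auto
    then show "\<beta> (e i) + \<beta> (e (n + 1 - i)) = 0" using dual[OF i] i by (simp add: \<beta>e b c_def)
  next
    show "\<beta> (e (m + 1)) = delta_inv \<sigma> \<omega> / 2" using \<beta>e[OF m1(1)] td by (simp add: c_def)
  qed
  have "\<alpha> x \<le> \<beta> x" for x
  proof (rule ereal_le_by_reals)
    fix r assume "ereal r < \<alpha> x"
    then have r: "ereal r \<le> \<alpha> x" by simp
    have off: "\<alpha> x \<le> \<alpha> (s (h (e (n + 1 - i)) x) (e i))" if "i \<in> {1..n}" "i \<noteq> m + 1" for i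
      by (rule norm_coord_ge[OF N M dual[OF that]])
    have shift: "ereal (r - c') \<le> y" if "ereal r \<le> y + ereal c'" for y c'
      using that by (cases y) auto
    define z where "z = (\<Sum>i\<in>{1..n} - {m + 1}. s (h (e (n + 1 - i)) x) (e i))"
    have "ereal r \<le> \<alpha> z" unfolding z_def using off r by (intro norm_ge_sum[OF N]) (auto intro: order_trans)
    moreover have "x = s (h (e (m + 1)) x) (e (m + 1)) + z"
      using expand[OF e, of x] sum.remove[of "{1..n}" "m + 1" "\<lambda>i. s (h (e (n + 1 - i)) x) (e i)"] m1
      by (simp add: z_def)
    ultimately have r0: "ereal r \<le> \<alpha> (s (h (e (m + 1)) x) (e (m + 1)))"
      using norm_ge_diff[OF N r, of z] by (metis add_diff_cancel_right')
    \<comment> \<open>The middle vector has \<open>h\<close>-square 1, so the quadratic condition on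
      \<alpha> there produces elements of trace 1, whose values are at most \<delta>.\<close>
    have "\<alpha> (e (m + 1)) \<le> ereal (d / 2)"
    proof (rule ereal_le_by_reals)
      fix q assume "ereal q < \<alpha> (e (m + 1))"
      then have "ereal q \<le> \<alpha> (e (m + 1))" by simp
      then obtain l where l: "l + \<sigma> l = h (e (m + 1)) (e (m + 1))" "ereal (2 * q) \<le> \<omega> l"
        using minorizes_quad[OF M] by blast
      have "l + \<sigma> l = 1" using l(1) antidiagonalD[OF e m1(1) m1(1)] m1(2) by simp
      then have "ereal (2 * q) \<le> ereal d" using l(2) val_le_delta td order_trans by metis
      then show "ereal q \<le> ereal (d / 2)" by simp
    qed
    then have "\<omega> (h (e (m + 1)) x) + \<alpha> (e (m + 1)) \<le> \<omega> (h (e (m + 1)) x) + ereal (d / 2)"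
      by (rule add_left_mono)
    then have mid: "ereal (r - d / 2) \<le> \<omega> (h (e (m + 1)) x)"
      using r0 unfolding norm_scale[OF N UNIV_I] by (intro shift) (rule order_trans)
    show "ereal r \<le> \<beta> x"
      unfolding \<beta>_def basis_norm_ge
    proof
      fix i assume i: "i \<in> {1..n}"
      show "ereal (r - c i) \<le> \<omega> (h (e (n + 1 - i)) x)"
      proof (cases "i = m + 1")
        case True
        then show ?thesis using mid m1(2) by (simp add: c_def)
      next
        case False
        have "ereal r \<le> \<omega> (h (e (n + 1 - i)) x) + ereal (b i)"
          using order_trans[OF r off[OF i False]] norm_scale[OF N UNIV_I] b[OF i] by simp
        then show ?thesis using False shift by (simp add: c_def)
      qed
    qed
  qed
  then have "\<beta> = \<alpha>" using max NB \<beta>mm unfolding maxi_minorant_norms_def by blast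
  then show thesis
    using that[OF e dual] adapted \<beta>e[OF m1(1)] td by (simp add: c_def)
qed

section \<open>Graded lattice chains\<close>

text \<open>Grades are infima of \<alpha>, hence at most \<open>\<alpha> x\<close> on lattices
  containing \<open>x\<close>; conversely the level set at any \<open>r < \<alpha> x\<close>
  contains \<open>x\<close> and has grade at least \<open>r\<close>.\<close>

lemma norm_of_chain_eq:
  assumes C: "chain_of_norm \<omega> s W \<alpha> C" and x: "x \<in> W"
  shows "norm_of_chain C x = \<alpha> x"
proof -
  obtain L c where Lc: "C = (L, c)" by fastforce
  have L: "L = {{x \<in> W. ereal r \<le> \<alpha> x} | r. True}" and c: "\<And>X. X \<in> L \<Longrightarrow> ereal (c X) = (INF x\<in>X. \<alpha> x)"
    using C by (auto simp: chain_of_norm_def Lc)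
  show ?thesis
  proof (rule antisym)
    show "norm_of_chain C x \<le> \<alpha> x"
      unfolding norm_of_chain_def Lc by (rule Sup_least) (auto simp: c intro: INF_lower)
    show "\<alpha> x \<le> norm_of_chain C x"
    proof (rule ereal_le_by_reals)
      fix r assume r: "ereal r < \<alpha> x"
      define X where "X = {x \<in> W. ereal r \<le> \<alpha> x}"
      have X: "X \<in> L" "x \<in> X" using r x by (auto simp: L X_def)
      have "ereal r \<le> ereal (c X)" unfolding c[OF X(1)] by (rule INF_greatest) (simp add: X_def)
      also have "\<dots> \<le> norm_of_chain C x"
        unfolding norm_of_chain_def Lc using X by (intro Sup_upper) auto
      finally show "ereal r \<le> norm_of_chain C x" .
    qed
  qed
qed

text \<open>Norms on \<open>W\<close> are functions on the whole type, so agreement on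
  \<open>W\<close> has to be transported. This lets a norm be exchanged for its dual.\<close>

lemma chain_of_norm_cong:
  assumes W: "subspace W" and eq: "\<And>x. x \<in> W \<Longrightarrow> \<alpha> x = \<beta> x" and C: "chain_of_norm \<omega> s W \<alpha> C"
  shows "chain_of_norm \<omega> s W \<beta> C"
proof -
  obtain L c where Lc: "C = (L, c)" by fastforce
  have N: "norm_on \<omega> s W \<alpha>" and L: "L = {{x \<in> W. ereal r \<le> \<alpha> x} | r. True}"
    and c: "\<And>X. X \<in> L \<Longrightarrow> ereal (c X) = (INF x\<in>X. \<alpha> x)"
    using C by (auto simp: chain_of_norm_def Lc)
  have "norm_on \<omega> s W \<beta>"
    using N eq subspace_add[OF W] subspace_scale[OF W] unfolding norm_on_def by (simp cong: ball_cong)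
  moreover have "{x \<in> W. ereal r \<le> \<alpha> x} = {x \<in> W. ereal r \<le> \<beta> x}" for r using eq by auto
  then have "L = {{x \<in> W. ereal r \<le> \<beta> x} | r. True}" unfolding L by simp
  moreover have "ereal (c X) = (INF x\<in>X. \<beta> x)" if X: "X \<in> L" for X
    unfolding c[OF X] by (rule INF_cong) (use X L eq in auto)
  ultimately show ?thesis by (simp add: chain_of_norm_def Lc)
qed

text \<open>Level sets are nested by their thresholds, and scaling by \<open>a\<close> shifts
  thresholds and infima by \<open>\<omega> a\<close>. The chain conditions follow from this once the
  level sets are known to be lattices.\<close>

lemma graded_lattice_chain_if_lattices:
  assumes W: "subspace W" and C: "chain_of_norm \<omega> s W \<alpha> (L, c)" and lat: "\<And>X. X \<in> L \<Longrightarrow> O_lattice \<omega> s W X"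
  shows "graded_lattice_chain \<omega> s W (L, c)"
proof -
  have N: "norm_on \<omega> s W \<alpha>" and L: "L = {{x \<in> W. ereal r \<le> \<alpha> x} | r. True}"
    and c: "\<And>X. X \<in> L \<Longrightarrow> ereal (c X) = (INF x\<in>X. \<alpha> x)"
    using C by (auto simp: chain_of_norm_def)
  have total: "X \<subseteq> Y \<or> Y \<subseteq> X" if XY: "X \<in> L" "Y \<in> L" for X Y
  proof -
    obtain r t where rt: "X = {x \<in> W. ereal r \<le> \<alpha> x}" "Y = {x \<in> W. ereal t \<le> \<alpha> x}" using XY L by blast
    have "r \<le> t \<or> t \<le> r" by linarith
    then show ?thesis unfolding rt by (auto intro: order_trans[rotated])
  qed
  have strict: "c Y < c X" if XY: "X \<in> L" "Y \<in> L" "X \<subset> Y" for X Y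
  proof -
    obtain r t where rt: "X = {x \<in> W. ereal r \<le> \<alpha> x}" "Y = {x \<in> W. ereal t \<le> \<alpha> x}" using XY L by blast
    obtain y where y: "y \<in> Y" "y \<notin> X" using XY(3) by blast
    have "ereal (c Y) \<le> \<alpha> y" unfolding c[OF XY(2)] by (rule INF_lower[OF y(1)])
    also have "\<alpha> y < ereal r" using y rt by auto
    also have "ereal r \<le> ereal (c X)" unfolding c[OF XY(1)] by (rule INF_greatest) (simp add: rt)
    finally show ?thesis by simp
  qed
  have scale: "s a ` X \<in> L \<and> ereal (c (s a ` X)) = \<omega> a + ereal (c X)" if X: "X \<in> L" and a: "a \<noteq> 0" for X a
  proof -
    obtain r where r: "X = {x \<in> W. ereal r \<le> \<alpha> x}" using X L by blast
    obtain w where w: "\<omega> a = ereal w" using val_finite[OF a] .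
    have shift: "ereal q \<le> \<alpha> (s a x) \<longleftrightarrow> ereal (q - w) \<le> \<alpha> x" if "x \<in> W" for x q
      unfolding norm_scale[OF N that] w by (cases "\<alpha> x") auto
    have "s a ` X = {x \<in> W. ereal (r + w) \<le> \<alpha> x}"
    proof (intro equalityI subsetI)
      fix y assume "y \<in> s a ` X"
      then show "y \<in> {x \<in> W. ereal (r + w) \<le> \<alpha> x}"
        using subspace_scale[OF W] shift by (auto simp: r)
    next
      fix y assume y: "y \<in> {x \<in> W. ereal (r + w) \<le> \<alpha> x}"
      have ya: "y = s a (s (inverse a) y)" "s (inverse a) y \<in> W" using a y subspace_scale[OF W] by simp_all
      then have "ereal r \<le> \<alpha> (s (inverse a) y)" using shift[OF ya(2), of "r + w"] y by simp
      then show "y \<in> s a ` X" using ya r by blast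
    qed
    then have aX: "s a ` X \<in> L" unfolding L by blast
    have XW: "X \<subseteq> W" using r by blast
    have "ereal q \<le> ereal (c (s a ` X)) \<longleftrightarrow> ereal (q - w) \<le> ereal (c X)" for q
      unfolding c[OF aX] c[OF X] le_INF_iff using shift XW by auto
    then have "q \<le> c (s a ` X) \<longleftrightarrow> q - w \<le> c X" for q by simp
    \<comment> \<open>The equivalence tested at each of the two numbers gives the two
      inequalities.\<close>
    from this[of "c (s a ` X)"] this[of "w + c X"] have "c (s a ` X) = w + c X" by simp
    then show ?thesis using aX w by simp
  qed
  have "L \<noteq> {}" unfolding L by blast
  then show ?thesis
    unfolding graded_lattice_chain_def using lat total strict scale by auto
qed

section \<open>Level sets of adapted norms\<close>

text \<open>Passes from a family of generators, as in \<open>O_basis\<close>, to a set of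
  generators, as in \<open>O_lattice\<close>.\<close>

lemma O_span_reindex:
  assumes inj: "inj_on g I"
  shows "O_span \<omega> s (g ` I) (\<lambda>b. b) = O_span \<omega> s I g"
proof (intro equalityI subsetI)
  fix x assume "x \<in> O_span \<omega> s (g ` I) (\<lambda>b. b)"
  then obtain a where a: "x = (\<Sum>b\<in>g ` I. s (a b) b)" "\<forall>b\<in>g ` I. a b \<in> ring_of_integers \<omega>"
    by (auto simp: O_span_def)
  have "x = (\<Sum>i\<in>I. s (a (g i)) (g i))" unfolding a(1) by (simp add: sum.reindex[OF inj])
  then show "x \<in> O_span \<omega> s I g" unfolding O_span_def using a(2) by (intro CollectI exI[of _ "\<lambda>i. a (g i)"]) auto
next
  fix x assume "x \<in> O_span \<omega> s I g"
  then obtain a where a: "x = (\<Sum>i\<in>I. s (a i) (g i))" "\<forall>i\<in>I. a i \<in> ring_of_integers \<omega>"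
    by (auto simp: O_span_def)
  have "x = (\<Sum>b\<in>g ` I. s (a (inv_into I g b)) b)"
    unfolding a(1) by (simp add: sum.reindex[OF inj] inv_into_f_f[OF inj])
  then show "x \<in> O_span \<omega> s (g ` I) (\<lambda>b. b)"
    unfolding O_span_def using a(2) inv_into_f_f[OF inj]
    by (intro CollectI exI[of _ "\<lambda>b. a (inv_into I g b)"]) auto
qed

text \<open>The restriction of \<open>\<alpha>\<close> to \<open>W\<close> as a graded chain; \<open>real_of_ereal\<close> is harmless if \<open>W \<noteq> {0}\<close>.\<close>
definition chain_on :: "'v set \<Rightarrow> ('v \<Rightarrow> ereal) \<Rightarrow> 'v graded_chain" where
  "chain_on W \<alpha> = ({{x \<in> W. ereal r \<le> \<alpha> x} | r. True}, \<lambda>X. real_of_ereal (INF x\<in>X. \<alpha> x))"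

text \<open>An adapted norm bounds each component separately, so a level set is a direct sum of
  fractional ideals along the \<open>e i\<close>, and each of these ideals is principal.\<close>

lemma level_set_O_basis:
  assumes N: "norm_on \<omega> s UNIV \<alpha>" and e: "antidiagonal_on h n e" and I: "I \<subseteq> {1..n}"
    and adapted: "\<And>x i. i \<in> {1..n} \<Longrightarrow> \<alpha> x \<le> \<alpha> (s (h (e (n + 1 - i)) x) (e i))"
  obtains a where "\<And>i. a i \<noteq> 0" "\<And>i. i \<in> I \<Longrightarrow> ereal r \<le> \<alpha> (s (a i) (e i))"
    "O_basis \<omega> s I (\<lambda>i. s (a i) (e i)) {x \<in> span (e ` I). ereal r \<le> \<alpha> x}"
proof -
  have fin: "finite I" using I finite_subset by blast
  have "\<exists>c. \<alpha> (e i) = ereal c" if "i \<in> I" for i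
    using norm_finite[OF N UNIV_I antidiagonal_nonzero[OF e]] that I by blast
  then obtain c where c: "\<And>i. i \<in> I \<Longrightarrow> \<alpha> (e i) = ereal (c i)" by metis
  \<comment> \<open>\<open>a i\<close> generates the ideal of coefficients allowed at
    \<open>e i\<close>. Minimality of its value makes the coordinates of a vector in the level set,
    divided by \<open>a i\<close>, integral.\<close>
  have "\<forall>i. \<exists>a. a \<noteq> 0 \<and> ereal (r - c i) \<le> \<omega> a \<and> (\<forall>x. ereal (r - c i) \<le> \<omega> x \<longrightarrow> \<omega> a \<le> \<omega> x)"
    using val_least_above by metis
  then obtain a where a: "\<And>i. a i \<noteq> 0" "\<And>i. ereal (r - c i) \<le> \<omega> (a i)"
    "\<And>i x. ereal (r - c i) \<le> \<omega> x \<Longrightarrow> \<omega> (a i) \<le> \<omega> x"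
    by metis
  have ge: "ereal r \<le> \<alpha> (s y (e i)) \<longleftrightarrow> ereal (r - c i) \<le> \<omega> y" if "i \<in> I" for y i
    unfolding norm_scale[OF N UNIV_I] c[OF that] by (cases "\<omega> y") auto
  have gen: "ereal r \<le> \<alpha> (s (a i) (e i))" if "i \<in> I" for i
    unfolding ge[OF that] by (rule a(2))
  have assoc: "(\<Sum>i\<in>I. s (b i) (s (a i) (e i))) = (\<Sum>i\<in>I. s (b i * a i) (e i))" for b
    by simp
  have "{x \<in> span (e ` I). ereal r \<le> \<alpha> x} = O_span \<omega> s I (\<lambda>i. s (a i) (e i))"
  proof (intro equalityI subsetI)
    fix x assume x: "x \<in> {x \<in> span (e ` I). ereal r \<le> \<alpha> x}"
    define b where "b i = h (e (n + 1 - i)) x / a i" for i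
    have "x = (\<Sum>i\<in>I. s (b i) (s (a i) (e i)))"
      unfolding assoc using span_coord(1)[OF e I, of x] x a(1) by (simp add: b_def)
    moreover have "b i \<in> ring_of_integers \<omega>" if i: "i \<in> I" for i
    proof -
      have "ereal r \<le> \<alpha> (s (h (e (n + 1 - i)) x) (e i))" using x adapted[of i x] i I order_trans by blast
      then have le: "\<omega> (a i) \<le> \<omega> (b i * a i)"
        unfolding ge[OF i] using a(1,3)[of i] by (simp add: b_def)
      obtain w where "\<omega> (a i) = ereal w" using val_finite[OF a(1)] by blast
      then have "0 \<le> \<omega> (b i)"
        using le unfolding val_mult by (cases "\<omega> (b i)") (auto simp: zero_ereal_def)
      then show ?thesis by (simp add: ring_of_integers_def)
    qed
    ultimately show "x \<in> O_span \<omega> s I (\<lambda>i. s (a i) (e i))" unfolding O_span_def by blast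
  next
    fix x assume "x \<in> O_span \<omega> s I (\<lambda>i. s (a i) (e i))"
    then obtain b where x: "x = (\<Sum>i\<in>I. s (b i) (s (a i) (e i)))" and b: "\<And>i. i \<in> I \<Longrightarrow> ereal 0 \<le> \<omega> (b i)"
      by (auto simp: O_span_def ring_of_integers_def zero_ereal_def)
    have "x \<in> span (e ` I)" unfolding x by (intro span_sum span_scale span_base imageI)
    moreover have "ereal (0 + r) \<le> \<alpha> x"
      unfolding x using gen b by (intro norm_ge_sum[OF N] norm_ge_scale[OF N UNIV_I]) auto
    ultimately show "x \<in> {x \<in> span (e ` I). ereal r \<le> \<alpha> x}" by simp
  qed
  moreover have "b i = 0" if "(\<Sum>i\<in>I. s (b i) (s (a i) (e i))) = 0" "i \<in> I" for b i
    using antidiagonal_coord[OF e I, of i "\<lambda>i. b i * a i"] that I a(1)[of i] unfolding assoc by auto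
  ultimately have "O_basis \<omega> s I (\<lambda>i. s (a i) (e i)) {x \<in> span (e ` I). ereal r \<le> \<alpha> x}"
    unfolding O_basis_def by blast
  then show thesis using that[of a] a(1) gen by blast
qed

lemma level_set_lattice:
  assumes N: "norm_on \<omega> s UNIV \<alpha>" and e: "antidiagonal_on h n e" and I: "I \<subseteq> {1..n}"
    and adapted: "\<And>x i. i \<in> {1..n} \<Longrightarrow> \<alpha> x \<le> \<alpha> (s (h (e (n + 1 - i)) x) (e i))"
  shows "O_lattice \<omega> s (span (e ` I)) {x \<in> span (e ` I). ereal r \<le> \<alpha> x}"
proof -
  let ?X = "{x \<in> span (e ` I). ereal r \<le> \<alpha> x}"
  have fin: "finite I" using I finite_subset by blast
  obtain a where a: "\<And>i. a i \<noteq> 0" "\<And>i. i \<in> I \<Longrightarrow> ereal r \<le> \<alpha> (s (a i) (e i))"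
    "O_basis \<omega> s I (\<lambda>i. s (a i) (e i)) ?X"
    using level_set_O_basis[OF N e I adapted] by blast
  have "inj_on (\<lambda>i. s (a i) (e i)) I"
  proof (rule inj_onI)
    fix i j assume ij: "i \<in> I" "j \<in> I" "s (a i) (e i) = s (a j) (e j)"
    then have "i \<in> {1..n}" "j \<in> {1..n}" using I by blast+
    moreover from this have "n + 1 - i \<in> {1..n}" "n + 1 - i = n + 1 - j \<longleftrightarrow> i = j" by auto
    ultimately have "h (e (n + 1 - i)) (e i) = 1" "h (e (n + 1 - i)) (e j) = (if i = j then 1 else 0)"
      using antidiagonalD[OF e] by simp_all
    moreover have "a i * h (e (n + 1 - i)) (e i) = a j * h (e (n + 1 - i)) (e j)"
      using arg_cong[OF ij(3), of "h (e (n + 1 - i))"] by (simp add: h_scale_right)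
    ultimately show "i = j" using a(1)[of i] by (auto split: if_splits)
  qed
  then have "?X = O_span \<omega> s ((\<lambda>i. s (a i) (e i)) ` I) (\<lambda>b. b)"
    using a(3) O_span_reindex unfolding O_basis_def by metis
  moreover have "span ?X = span (e ` I)"
  proof (rule antisym)
    show "span ?X \<subseteq> span (e ` I)" by (rule span_minimal) auto
    show "span (e ` I) \<subseteq> span ?X"
    proof (rule span_minimal)
      show "e ` I \<subseteq> span ?X"
      proof
        fix y assume "y \<in> e ` I"
        then obtain i where i: "i \<in> I" "y = e i" by blast
        have "s (a i) (e i) \<in> ?X" using a(2)[OF i(1)] i by (auto intro: span_scale span_base)
        then have "s (inverse (a i)) (s (a i) (e i)) \<in> span ?X" by (intro span_scale span_base)
        then show "y \<in> span ?X" using a(1) i by simp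
      qed
    qed simp
  qed
  ultimately show ?thesis unfolding O_lattice_def using fin by blast
qed

lemma chain_on_chain:
  assumes N: "norm_on \<omega> s UNIV \<alpha>" and e: "antidiagonal_on h n e" and I: "I \<subseteq> {1..n}" "I \<noteq> {}"
    and adapted: "\<And>x i. i \<in> {1..n} \<Longrightarrow> \<alpha> x \<le> \<alpha> (s (h (e (n + 1 - i)) x) (e i))"
  shows "chain_of_norm \<omega> s (span (e ` I)) \<alpha> (chain_on (span (e ` I)) \<alpha>)"
    and "graded_lattice_chain \<omega> s (span (e ` I)) (chain_on (span (e ` I)) \<alpha>)"
proof -
  let ?W = "span (e ` I)"
  \<comment> \<open>The infimum lies between \<open>r\<close> and the finite norm of a non-zero
    generator, which exists because \<open>I\<close> is non-empty.\<close>
  have "ereal (real_of_ereal (INF x\<in>X. \<alpha> x)) = (INF x\<in>X. \<alpha> x)" if X: "X = {x \<in> ?W. ereal r \<le> \<alpha> x}" for X r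
  proof -
    obtain a where a: "\<And>i. a i \<noteq> 0" "\<And>i. i \<in> I \<Longrightarrow> ereal r \<le> \<alpha> (s (a i) (e i))"
      using level_set_O_basis[OF N e I(1) adapted] by blast
    obtain i where i: "i \<in> I" using I(2) by blast
    have "s (a i) (e i) \<noteq> 0" using a(1)[of i] antidiagonal_nonzero[OF e] i I(1) by auto
    then obtain q where q: "\<alpha> (s (a i) (e i)) = ereal q" using norm_finite[OF N UNIV_I] by blast
    have "s (a i) (e i) \<in> X" using a(2)[OF i] i unfolding X by (auto intro: span_scale span_base)
    then have "(INF x\<in>X. \<alpha> x) \<le> ereal q" using q by (metis INF_lower)
    moreover have "ereal r \<le> (INF x\<in>X. \<alpha> x)" by (rule INF_greatest) (simp add: X)
    ultimately show ?thesis by (cases "INF x\<in>X. \<alpha> x") auto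
  qed
  then show C: "chain_of_norm \<omega> s ?W \<alpha> (chain_on ?W \<alpha>)"
    unfolding chain_of_norm_def chain_on_def using norm_on_subset[OF N] by auto
  show "graded_lattice_chain \<omega> s ?W (chain_on ?W \<alpha>)"
    unfolding chain_on_def
  proof (rule graded_lattice_chain_if_lattices)
    show "subspace ?W" by simp
    show "chain_of_norm \<omega> s ?W \<alpha> ({{x \<in> ?W. ereal r \<le> \<alpha> x} | r. True}, \<lambda>X. real_of_ereal (INF x\<in>X. \<alpha> x))"
      using C unfolding chain_on_def .
    show "O_lattice \<omega> s ?W X" if "X \<in> {{x \<in> ?W. ereal r \<le> \<alpha> x} | r. True}" for X
      using that level_set_lattice[OF N e I(1) adapted] by blast
  qed
qed

lemma adapted_chain_on:
  assumes N: "norm_on \<omega> s UNIV \<alpha>" and e: "antidiagonal_on h n e" and I: "I \<subseteq> {1..n}"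
    and adapted: "\<And>x i. i \<in> {1..n} \<Longrightarrow> \<alpha> x \<le> \<alpha> (s (h (e (n + 1 - i)) x) (e i))"
  shows "adapted_basis \<omega> s (span (e ` I)) (chain_on (span (e ` I)) \<alpha>) I e"
proof -
  have "is_basis s I e (span (e ` I))"
    unfolding is_basis_def
    using antidiagonal_independent[OF e I] inj_on_subset[OF antidiagonal_inj[OF e] I] by blast
  moreover have "\<exists>a. O_basis \<omega> s I (\<lambda>i. s (a i) (e i)) X" if X: "X \<in> fst (chain_on (span (e ` I)) \<alpha>)" for X
  proof -
    obtain r where "X = {x \<in> span (e ` I). ereal r \<le> \<alpha> x}"
      using X unfolding chain_on_def by auto
    then show ?thesis using level_set_O_basis[OF N e I adapted] by metis
  qed
  ultimately show ?thesis unfolding adapted_basis_def by blast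
qed

text \<open>Minorization says that \<alpha> is at most its dual. Conversely, testing the dual at the
  partners \<open>e (n + 1 - i)\<close> bounds each component of \<open>x\<close>, and these bounds
  add up to one on \<open>\<alpha> x\<close>. Agreement of \<open>N'\<close> with \<alpha> on
  \<open>W\<close> covers the norm read off from a chain.\<close>

lemma dual_norm_eq:
  assumes N: "norm_on \<omega> s UNIV \<alpha>" and e: "antidiagonal_on h n e" and M: "minorizes \<sigma> \<omega> h \<alpha>"
    and dual: "\<And>i. i \<in> {1..n} \<Longrightarrow> i \<noteq> m + 1 \<Longrightarrow> \<alpha> (e i) + \<alpha> (e (n + 1 - i)) = 0"
    and W: "W = span (e ` ({1..n} - {m + 1}))" and x: "x \<in> W"
    and eq: "\<And>y. y \<in> W \<Longrightarrow> N' y = \<alpha> y"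
  shows "dual_norm \<omega> h W N' x = \<alpha> x"
proof (rule antisym)
  have "\<alpha> x \<le> \<omega> (h x y) - \<alpha> y" if y: "y \<in> W - {0}" for y
  proof -
    obtain b where b: "\<alpha> y = ereal b" using norm_finite[OF N UNIV_I, of y] y by blast
    have "\<alpha> x + \<alpha> y \<le> \<omega> (h x y)" using M unfolding minorizes_def by blast
    then show ?thesis unfolding b by (cases "\<alpha> x"; cases "\<omega> (h x y)") auto
  qed
  then show "\<alpha> x \<le> dual_norm \<omega> h W N' x"
    unfolding dual_norm_def by (intro INF_greatest) (simp add: eq)
  show "dual_norm \<omega> h W N' x \<le> \<alpha> x"
  proof (rule ereal_le_by_reals)
    fix r assume r: "ereal r < dual_norm \<omega> h W N' x"
    have "ereal r \<le> \<alpha> (s (h (e (n + 1 - i)) x) (e i))" if i: "i \<in> {1..n} - {m + 1}" for i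
    proof -
      have i': "n + 1 - i \<in> {1..n} - {m + 1}" using i odd_dim by auto
      have W': "e (n + 1 - i) \<in> W - {0}"
        using i' antidiagonal_nonzero[OF e, of "n + 1 - i"] unfolding W by (auto intro: span_base)
      obtain b where b: "\<alpha> (e (n + 1 - i)) = ereal b" using norm_finite[OF N UNIV_I, of "e (n + 1 - i)"] W' by blast
      have a: "\<alpha> (e i) = ereal (- b)"
        using dual[of i] i b N unfolding norm_on_def by (cases "\<alpha> (e i)") (auto simp: zero_ereal_def)
      have "ereal r \<le> \<omega> (h x (e (n + 1 - i))) - \<alpha> (e (n + 1 - i))"
        using r INF_lower[OF W', of "\<lambda>y. \<omega> (h x y) - N' y"] eq[of "e (n + 1 - i)"] W'
        unfolding dual_norm_def by simp
      also have "\<omega> (h x (e (n + 1 - i))) = \<omega> (h (e (n + 1 - i)) x)"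
        using h_swap[of x "e (n + 1 - i)"] by simp
      finally show ?thesis
        unfolding norm_scale[OF N UNIV_I] a b by (cases "\<omega> (h (e (n + 1 - i)) x)") auto
    qed
    moreover have "x = (\<Sum>i\<in>{1..n} - {m + 1}. s (h (e (n + 1 - i)) x) (e i))"
      using span_coord(1)[OF e _ x[unfolded W]] by blast
    ultimately show "ereal r \<le> \<alpha> x"
      using norm_ge_sum[OF N, of "{1..n} - {m + 1}" "ereal r" "\<lambda>i. s (h (e (n + 1 - i)) x) (e i)"] by simp
  qed
qed

section \<open>Witt decompositions of antidiagonal bases\<close>

text \<open>\<open>A\<close> picks one index from each pair. Orthogonality to the span kills every
  coordinate outside \<open>A\<close> except the middle one; then \<open>h x x\<close> is the norm
  of the middle coordinate, which vanishes if \<open>x\<close> is isotropic.\<close>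

lemma maximal_isotropic_span:
  assumes e: "antidiagonal_on h n e" and A: "A \<subseteq> {1..n} - {m + 1}"
    and part: "\<And>i. i \<in> {1..n} - {m + 1} \<Longrightarrow> i \<in> A \<longleftrightarrow> n + 1 - i \<notin> A"
  shows "maximal_isotropic s h (span (e ` A))"
proof -
  have A': "A \<subseteq> {1..n}" using A by blast
  note iff = span_iff_coord[OF e A']
  have inv: "n + 1 - (n + 1 - i) = i" if "i \<in> {1..n}" for i using that by auto
  have "h x y = 0" if xy: "x \<in> span (e ` A)" "y \<in> span (e ` A)" for x y
    unfolding h_eq_sum_coords[OF e, of x y]
  proof (rule sum.neutral, rule ballI)
    fix i assume i: "i \<in> {1..n}"
    show "\<sigma> (h (e (n + 1 - i)) x) * h (e i) y = 0"
    proof (cases "i \<in> A")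
      case True
      then have "n + 1 - i \<in> {1..n} - A" using part[of i] A i by auto
      then have "h (e i) y = 0" using xy(2) unfolding iff using inv[OF i] by metis
      then show ?thesis by simp
    next
      case False
      then show ?thesis using xy(1) i unfolding iff by simp
    qed
  qed
  moreover have "U \<subseteq> span (e ` A)" if U: "totally_isotropic s h U" "span (e ` A) \<subseteq> U" for U
  proof
    fix x assume x: "x \<in> U"
    have off: "h (e (n + 1 - i)) x = 0" if i: "i \<in> {1..n} - A" "i \<noteq> m + 1" for i
    proof -
      have "n + 1 - i \<in> A" using part[of i] i by blast
      then have "e (n + 1 - i) \<in> U" using U(2) span_base by blast
      then show ?thesis using U(1) x unfolding totally_isotropic_def by blast
    qed
    have m1: "m + 1 \<in> {1..n}" "n + 1 - (m + 1) = m + 1" using odd_dim by auto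
    have "0 = h x x" using U(1) x unfolding totally_isotropic_def by simp
    also have "\<dots> = (\<Sum>i\<in>{m + 1}. \<sigma> (h (e (n + 1 - i)) x) * h (e i) x)"
      unfolding h_eq_sum_coords[OF e, of x x]
    proof (rule sum.mono_neutral_right)
      show "\<forall>i\<in>{1..n} - {m + 1}. \<sigma> (h (e (n + 1 - i)) x) * h (e i) x = 0"
      proof
        fix i assume i: "i \<in> {1..n} - {m + 1}"
        show "\<sigma> (h (e (n + 1 - i)) x) * h (e i) x = 0"
        proof (cases "i \<in> A")
          case True
          then have "n + 1 - i \<in> {1..n} - A" "n + 1 - i \<noteq> m + 1" using part[of i] i odd_dim by auto
          then have "h (e (n + 1 - (n + 1 - i))) x = 0" by (rule off)
          then show ?thesis using inv i by simp
        qed (use off i in simp)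
      qed
    qed (use m1 in auto)
    finally have "\<sigma> (h (e (m + 1)) x) * h (e (m + 1)) x = 0" using m1(2) by simp
    then have mid: "h (e (m + 1)) x = 0" by simp
    have "h (e (n + 1 - i)) x = 0" if "i \<in> {1..n} - A" for i
      using off[OF that] mid m1(2) by (cases "i = m + 1") metis+
    then show "x \<in> span (e ` A)" unfolding iff by blast
  qed
  ultimately show ?thesis
    unfolding maximal_isotropic_def totally_isotropic_def[of s h "span (e ` A)"] by auto
qed

lemma V_pm_eq: "V_pm s m e = span (e ` ({1..n} - {m + 1}))"
proof -
  have "{1..n} - {m + 1} = {1..m} \<union> {m + 2..2 * m + 1}" using odd_dim by auto
  then show ?thesis
    unfolding subspace_sum_def V_minus_def V_plus_def by (simp add: image_Un span_Un)
qed

lemma V_zero_eq: "V_zero s m e = span (e ` {m + 1})"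
  by (simp add: V_zero_def)

lemma V_pm_V_zero:
  assumes e: "antidiagonal_on h n e"
  shows "V_pm s m e \<inter> V_zero s m e = {0}" and "subspace_sum (V_pm s m e) (V_zero s m e) = UNIV"
proof -
  have m1: "m + 1 \<in> {1..n}" using odd_dim by auto
  show "V_pm s m e \<inter> V_zero s m e = {0}"
  proof (intro equalityI subsetI)
    fix x assume "x \<in> V_pm s m e \<inter> V_zero s m e"
    then have x: "x \<in> span (e ` ({1..n} - {m + 1}))" "x \<in> span (e ` {m + 1})"
      unfolding V_pm_eq V_zero_eq by blast+
    have "h (e (n + 1 - i)) x = 0" if "i \<in> {1..n}" for i
      using span_coord(2)[OF e _ x(1), of i] span_coord(2)[OF e _ x(2), of i] m1 that by blast
    then show "x \<in> {0}" using expand[OF e, of x] by simp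
  next
    fix x :: 'v assume "x \<in> {0}"
    then show "x \<in> V_pm s m e \<inter> V_zero s m e" unfolding V_pm_eq V_zero_eq using span_zero by blast
  qed
  have "e ` ({1..n} - {m + 1}) \<union> e ` {m + 1} = e ` {1..n}" using m1 by blast
  then have "span (e ` ({1..n} - {m + 1}) \<union> e ` {m + 1}) = UNIV"
    using antidiagonal_is_basis[OF e] by (simp only: is_basis_def)
  then show "subspace_sum (V_pm s m e) (V_zero s m e) = UNIV"
    unfolding V_pm_eq V_zero_eq span_Un subspace_sum_def[of "span (e ` ({1..n} - {m + 1}))"] .
qed

lemma antidiagonal_induces_Witt_decomposition:
  assumes e: "antidiagonal_on h n e"
  shows "induces_Witt_decomposition s h m e"
proof -
  have m1: "m + 1 \<in> {1..n}" "n + 1 - (m + 1) = m + 1" using odd_dim by auto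
  have "maximal_isotropic s h (V_minus s m e)"
    unfolding V_minus_def by (rule maximal_isotropic_span[OF e]) (use odd_dim in auto)
  moreover have "maximal_isotropic s h (V_plus s m e)"
    unfolding V_plus_def by (rule maximal_isotropic_span[OF e]) (use odd_dim in auto)
  moreover have "V_zero s m e = {x. \<forall>y\<in>V_pm s m e. h x y = 0}"
  proof (intro equalityI subsetI)
    fix x assume x: "x \<in> V_zero s m e"
    have "h x y = 0" if y: "y \<in> V_pm s m e" for y
      unfolding h_eq_sum_coords[OF e, of x y]
    proof (rule sum.neutral, rule ballI)
      fix i assume i: "i \<in> {1..n}"
      show "\<sigma> (h (e (n + 1 - i)) x) * h (e i) y = 0"
      proof (cases "i = m + 1")
        case True
        then have "h (e i) y = 0"
          using span_coord(2)[OF e _ y[unfolded V_pm_eq], of "m + 1"] m1 by auto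
        then show ?thesis by simp
      next
        case False
        then have "h (e (n + 1 - i)) x = 0"
          using span_coord(2)[OF e _ x[unfolded V_zero_eq], of i] m1 i by blast
        then show ?thesis by simp
      qed
    qed
    then show "x \<in> {x. \<forall>y\<in>V_pm s m e. h x y = 0}" by blast
  next
    fix x assume x: "x \<in> {x. \<forall>y\<in>V_pm s m e. h x y = 0}"
    have "h (e (n + 1 - i)) x = 0" if "i \<in> {1..n} - {m + 1}" for i
    proof -
      have "n + 1 - i \<in> {1..n} - {m + 1}" using that odd_dim by auto
      then have "e (n + 1 - i) \<in> V_pm s m e" unfolding V_pm_eq by (intro span_base imageI)
      then show ?thesis using x h_swap[of "e (n + 1 - i)" x] by simp
    qed
    then show "x \<in> V_zero s m e" unfolding V_zero_eq using span_iff_coord[OF e, of "{m + 1}" x] m1 by blast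
  qed
  ultimately show ?thesis
    unfolding induces_Witt_decomposition_def using e odd_dim by simp
qed

section \<open>The two implications\<close>

text \<open>Both summands are level-set chains of restrictions of \<alpha>. Adaptedness of the Witt
  basis makes \<alpha> their direct sum, and the dual pairs make the hyperbolic part
  self-dual.\<close>

lemma decomposition_of_maxi_minorant:
  assumes \<alpha>: "\<alpha> \<in> maxi_minorant_norms \<sigma> \<omega> s h" and C: "chain_of_norm \<omega> s UNIV \<alpha> C"
  shows "\<exists>f Lpm cpm L0 c0.
       is_basis s {1..n} f UNIV \<and>
       induces_Witt_decomposition s h m f \<and>
       chain_direct_sum \<omega> s (V_pm s m f) (Lpm, cpm) (V_zero s m f) (L0, c0) C \<and>
       self_dual_chain \<omega> s h (V_pm s m f) (Lpm, cpm) \<and>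
       adapted_basis \<omega> s (V_pm s m f) (Lpm, cpm) ({1..n} - {m + 1}) f \<and>
       graded_lattice_chain \<omega> s (V_zero s m f) (L0, c0) \<and>
       (\<exists>\<alpha>\<^sub>0. norm_on \<omega> s (V_zero s m f) \<alpha>\<^sub>0 \<and>
             \<alpha>\<^sub>0 (f (m + 1)) = delta_inv \<sigma> \<omega> / 2 \<and>
             chain_of_norm \<omega> s (V_zero s m f) \<alpha>\<^sub>0 (L0, c0))"
proof -
  have N: "norm_on \<omega> s UNIV \<alpha>" and M: "minorizes \<sigma> \<omega> h \<alpha>"
    using \<alpha> unfolding maxi_minorant_norms_def by blast+
  obtain f where f: "antidiagonal_on h n f"
    and dual: "\<And>i. i \<in> {1..n} \<Longrightarrow> i \<noteq> m + 1 \<Longrightarrow> \<alpha> (f i) + \<alpha> (f (n + 1 - i)) = 0"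
    and mid: "\<alpha> (f (m + 1)) = delta_inv \<sigma> \<omega> / 2"
    and ad: "\<And>x i. i \<in> {1..n} \<Longrightarrow> \<alpha> x \<le> \<alpha> (s (h (f (n + 1 - i)) x) (f i))"
    using maxi_minorant_adapted[OF \<alpha>] by blast
  let ?I = "{1..n} - {m + 1}"
  have m1: "m + 1 \<in> {1..n}" "n + 1 - (m + 1) = m + 1" using odd_dim by auto
  have I: "?I \<subseteq> {1..n}" by blast
  have "1 \<in> ?I" using odd_dim dim_ge by auto
  then have I0: "?I \<noteq> {}" by blast
  have J: "{m + 1} \<subseteq> {1..n}" "{m + 1} \<noteq> {}" using m1 by auto
  let ?P = "V_pm s m f" and ?Z = "V_zero s m f"
  note P = chain_on_chain[OF N f I I0 ad, folded V_pm_eq]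
  note Z = chain_on_chain[OF N f J ad, folded V_zero_eq]
  have PN: "norm_of_chain (chain_on ?P \<alpha>) x = \<alpha> x" if "x \<in> ?P" for x by (rule norm_of_chain_eq[OF P(1) that])
  have ZN: "norm_of_chain (chain_on ?Z \<alpha>) x = \<alpha> x" if "x \<in> ?Z" for x by (rule norm_of_chain_eq[OF Z(1) that])
  \<comment> \<open>The middle component of \<open>x + z\<close> is \<open>z\<close>, so adaptedness
    gives the bound by \<open>\<alpha> z\<close>; subtracting \<open>z\<close> then gives the one by
    \<open>\<alpha> x\<close>.\<close>
  have "\<alpha> (x + z) = min (\<alpha> x) (\<alpha> z)" if x: "x \<in> ?P" and z: "z \<in> ?Z" for x z
  proof (rule antisym)
    have "h (f (m + 1)) x = 0"
      using span_coord(2)[OF f I x[unfolded V_pm_eq], of "m + 1"] m1 by auto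
    moreover have "z = s (h (f (m + 1)) z) (f (m + 1))"
      using span_coord(1)[OF f J(1) z[unfolded V_zero_eq]] m1(2) by simp
    ultimately have "\<alpha> (x + z) \<le> \<alpha> z"
      using ad[OF m1(1), of "x + z"] m1(2) by (simp add: h_add_right)
    moreover from this have "\<alpha> (x + z) \<le> \<alpha> x"
      using norm_ge_diff[OF N order_refl, of "x + z" z] by simp
    ultimately show "\<alpha> (x + z) \<le> min (\<alpha> x) (\<alpha> z)" by simp
    show "min (\<alpha> x) (\<alpha> z) \<le> \<alpha> (x + z)" using N unfolding norm_on_def by blast
  qed
  then have "chain_direct_sum \<omega> s ?P (chain_on ?P \<alpha>) ?Z (chain_on ?Z \<alpha>) C"
    unfolding chain_direct_sum_def V_pm_V_zero[OF f] using C PN ZN by auto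
  moreover have "self_dual_chain \<omega> s h ?P (chain_on ?P \<alpha>)"
    unfolding self_dual_chain_def
  proof
    show "chain_of_norm \<omega> s ?P (dual_norm \<omega> h ?P (norm_of_chain (chain_on ?P \<alpha>))) (chain_on ?P \<alpha>)"
    proof (rule chain_of_norm_cong[OF _ _ P(1)])
      show "subspace ?P" unfolding V_pm_eq by simp
      show "\<alpha> x = dual_norm \<omega> h ?P (norm_of_chain (chain_on ?P \<alpha>)) x" if "x \<in> ?P" for x
        using dual_norm_eq[OF N f M dual V_pm_eq that PN] by simp
    qed
  qed (rule P(2))
  moreover have "adapted_basis \<omega> s ?P (chain_on ?P \<alpha>) ?I f"
    using adapted_chain_on[OF N f I ad] unfolding V_pm_eq .
  moreover have "norm_on \<omega> s ?Z \<alpha>" using norm_on_subset[OF N] by blast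
  ultimately show ?thesis
    using antidiagonal_is_basis[OF f] antidiagonal_induces_Witt_decomposition[OF f] Z mid
    unfolding chain_on_def by blast
qed

text \<open>The norm of the sum satisfies the criterion for maxi-minorant norms: the adapted lattice
  bases make it adapted, and self-duality yields opposite values on each hyperbolic pair.\<close>

lemma maxi_minorant_of_decomposition:
  assumes f: "antidiagonal_on h n f"
    and sum: "chain_direct_sum \<omega> s (V_pm s m f) Cpm (V_zero s m f) C0 C"
    and sd: "self_dual_chain \<omega> s h (V_pm s m f) Cpm"
    and ad: "adapted_basis \<omega> s (V_pm s m f) Cpm ({1..n} - {m + 1}) f"
    and \<alpha>0: "\<alpha>\<^sub>0 (f (m + 1)) = delta_inv \<sigma> \<omega> / 2" "chain_of_norm \<omega> s (V_zero s m f) \<alpha>\<^sub>0 C0"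
  shows "\<exists>\<alpha> \<in> maxi_minorant_norms \<sigma> \<omega> s h. chain_of_norm \<omega> s UNIV \<alpha> C"
proof -
  let ?P = "V_pm s m f" and ?Z = "V_zero s m f" and ?I = "{1..n} - {m + 1}"
  let ?\<alpha>' = "dual_norm \<omega> h ?P (norm_of_chain Cpm)"
  have m1: "m + 1 \<in> {1..n}" "n + 1 - (m + 1) = m + 1" using odd_dim by auto
  have I: "?I \<subseteq> {1..n}" by blast
  have J: "{m + 1} \<subseteq> {1..n}" using m1 by blast
  have inv: "n + 1 - i \<in> ?I" "n + 1 - (n + 1 - i) = i" if "i \<in> ?I" for i using that odd_dim by auto
  obtain \<beta> where \<beta>: "\<And>x z. x \<in> ?P \<Longrightarrow> z \<in> ?Z \<Longrightarrow> \<beta> (x + z) = min (norm_of_chain Cpm x) (norm_of_chain C0 z)"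
    and C: "chain_of_norm \<omega> s UNIV \<beta> C"
    using sum unfolding chain_direct_sum_def V_pm_V_zero[OF f] by blast
  have N: "norm_on \<omega> s UNIV \<beta>" using C by (auto simp: chain_of_norm_def)
  have P: "chain_of_norm \<omega> s ?P ?\<alpha>' Cpm" using sd by (simp add: self_dual_chain_def)
  have zero: "0 \<in> ?P" "0 \<in> ?Z" unfolding V_pm_eq V_zero_eq by (rule span_zero)+
  have NP: "norm_on \<omega> s ?P ?\<alpha>'" and NZ: "norm_on \<omega> s ?Z \<alpha>\<^sub>0"
    using P \<alpha>0(2) by (auto simp: chain_of_norm_def)
  note Peq = norm_of_chain_eq[OF P] and Zeq = norm_of_chain_eq[OF \<alpha>0(2)]
  have \<beta>P: "\<beta> x = norm_of_chain Cpm x" if "x \<in> ?P" for x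
    using \<beta>[OF that zero(2)] Zeq[OF zero(2)] norm_zero[OF NZ zero(2)] by simp
  have \<beta>Z: "\<beta> z = \<alpha>\<^sub>0 z" if "z \<in> ?Z" for z
    using \<beta>[OF zero(1) that] Peq[OF zero(1)] norm_zero[OF NP zero(1)] Zeq[OF that] by simp
  have \<beta>\<alpha>': "?\<alpha>' x = \<beta> x" if "x \<in> ?P" for x using Peq[OF that] \<beta>P[OF that] by simp
  \<comment> \<open>The level set at \<open>r\<close> has an integral basis of multiples of the
    \<open>f i\<close>. Hence each component of \<open>x\<close> is an integral multiple of a basis
    vector lying in that level set.\<close>
  have coordP: "\<beta> x \<le> \<beta> (s (h (f (n + 1 - i)) x) (f i))" if x: "x \<in> ?P" and i: "i \<in> ?I" for x i
  proof (rule ereal_le_by_reals)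
    fix r assume r: "ereal r < \<beta> x"
    let ?X = "{x \<in> ?P. ereal r \<le> ?\<alpha>' x}"
    have "?X \<in> fst Cpm" using P by (cases Cpm) (auto simp: chain_of_norm_def)
    then obtain a where a: "O_basis \<omega> s ?I (\<lambda>i. s (a i) (f i)) ?X"
      using ad unfolding adapted_basis_def by blast
    have "x \<in> ?X" using x r \<beta>\<alpha>' by simp
    then obtain b where b: "x = (\<Sum>i\<in>?I. s (b i) (s (a i) (f i)))" "\<forall>i\<in>?I. b i \<in> ring_of_integers \<omega>"
      using a unfolding O_basis_def O_span_def by blast
    have xi: "h (f (n + 1 - i)) x = b i * a i"
      using antidiagonal_coord[OF f I, of i "\<lambda>i. b i * a i"] i b(1) by simp
    have "s (a i) (f i) = (\<Sum>j\<in>?I. s (if j = i then 1 else 0) (s (a j) (f j)))"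
    proof -
      have "(\<Sum>j\<in>?I. s (if j = i then 1 else 0) (s (a j) (f j))) = (\<Sum>j\<in>?I. if j = i then s (a j) (f j) else 0)"
        by (rule sum.cong) simp_all
      then show ?thesis using i by (simp add: sum.delta')
    qed
    moreover have "\<forall>j\<in>?I. (if j = i then 1 else 0) \<in> ring_of_integers \<omega>"
      by (simp add: ring_of_integers_def)
    ultimately have "s (a i) (f i) \<in> O_span \<omega> s ?I (\<lambda>i. s (a i) (f i))"
      unfolding O_span_def by (intro CollectI exI[of _ "\<lambda>j. if j = i then 1 else 0"] conjI)
    then have "s (a i) (f i) \<in> ?X" using a unfolding O_basis_def by simp
    then have "ereal r \<le> \<beta> (s (a i) (f i))" using \<beta>\<alpha>' by auto
    moreover have "ereal 0 \<le> \<omega> (b i)" using b(2) i by (simp add: ring_of_integers_def zero_ereal_def)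
    ultimately have "ereal (0 + r) \<le> \<beta> (s (b i) (s (a i) (f i)))" by (rule norm_ge_scale[OF N UNIV_I])
    then show "ereal r \<le> \<beta> (s (h (f (n + 1 - i)) x) (f i))" using xi by simp
  qed
  have "\<beta> \<in> maxi_minorant_norms \<sigma> \<omega> s h"
  proof (rule maxi_minorant_if_adapted[OF N f])
    fix y i assume i: "i \<in> {1..n}"
    have "y \<in> subspace_sum ?P ?Z" using V_pm_V_zero(2)[OF f] by simp
    then obtain x z where xz: "y = x + z" "x \<in> ?P" "z \<in> ?Z"
      unfolding subspace_sum_def[of ?P ?Z] by blast
    have y: "\<beta> y \<le> \<beta> x" "\<beta> y \<le> \<beta> z"
      using \<beta>[OF xz(2,3)] \<beta>P[OF xz(2)] \<beta>Z[OF xz(3)] Zeq[OF xz(3)] xz(1) by simp_all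
    show "\<beta> y \<le> \<beta> (s (h (f (n + 1 - i)) y) (f i))"
    proof (cases "i = m + 1")
      case True
      have "h (f (m + 1)) x = 0"
        using span_coord(2)[OF f I xz(2)[unfolded V_pm_eq], of "m + 1"] m1 by auto
      moreover have "z = s (h (f (m + 1)) z) (f (m + 1))"
        using span_coord(1)[OF f J xz(3)[unfolded V_zero_eq]] m1(2) by simp
      ultimately show ?thesis using y(2) True m1(2) xz(1) by (simp add: h_add_right)
    next
      case False
      have "h (f (n + 1 - i)) z = 0"
        using span_coord(2)[OF f J xz(3)[unfolded V_zero_eq], of i] i False by blast
      then show ?thesis
        using order_trans[OF y(1) coordP[OF xz(2), of i]] i False xz(1) by (simp add: h_add_right)
    qed
  next
    fix i assume i: "i \<in> {1..n}" "i \<noteq> m + 1"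
    let ?j = "n + 1 - i"
    have ij: "i \<in> ?I" "?j \<in> ?I" "n + 1 - ?j = i" using i inv[of i] by auto
    have fP: "f k \<in> ?P" "f k \<noteq> 0" if "k \<in> ?I" for k
      using that antidiagonal_nonzero[OF f, of k] unfolding V_pm_eq by (auto intro: span_base)
    obtain a where a: "\<beta> (f i) = ereal a" using norm_finite[OF N UNIV_I fP(2)[OF ij(1)]] by blast
    obtain b where b: "\<beta> (f ?j) = ereal b" using norm_finite[OF N UNIV_I fP(2)[OF ij(2)]] by blast
    \<comment> \<open>Self-duality at \<open>f i\<close>. Testing at the partner bounds the infimum
      by \<open>- b\<close>; the component bound along the partner shows that no \<open>y\<close>
      goes below it.\<close>
    have dual: "ereal a = (INF y\<in>?P - {0}. \<omega> (h (f i) y) - \<beta> y)"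
      unfolding a[symmetric] \<beta>\<alpha>'[OF fP(1)[OF ij(1)], symmetric] dual_norm_def
      by (rule INF_cong) (simp_all add: \<beta>P)
    have "h (f i) (f ?j) = 1" using antidiagonalD[OF f, of i ?j] ij by auto
    then have "\<omega> (h (f i) (f ?j)) - \<beta> (f ?j) = ereal (- b)" unfolding b by simp
    moreover have "f ?j \<in> ?P - {0}" using fP[OF ij(2)] by blast
    ultimately have "ereal a \<le> ereal (- b)" unfolding dual by (metis (no_types, lifting) INF_lower)
    moreover have "ereal (- b) \<le> ereal a"
      unfolding dual
    proof (rule INF_greatest)
      fix y assume y: "y \<in> ?P - {0}"
      have "\<beta> y \<le> \<omega> (h (f i) y) + ereal b"
        using coordP[of y ?j] y ij norm_scale[OF N UNIV_I] b by simp
      moreover obtain q where "\<beta> y = ereal q" using norm_finite[OF N UNIV_I, of y] y by blast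
      ultimately show "ereal (- b) \<le> \<omega> (h (f i) y) - \<beta> y"
        by (cases "\<omega> (h (f i) y)") auto
    qed
    ultimately show "\<beta> (f i) + \<beta> (f ?j) = 0" using a b by (simp add: zero_ereal_def)
  next
    have "f (m + 1) \<in> ?Z" unfolding V_zero_eq by (auto intro: span_base)
    then show "\<beta> (f (m + 1)) = delta_inv \<sigma> \<omega> / 2" using \<beta>Z \<alpha>0(1) by simp
  qed
  then show ?thesis using C by blast
qed

end

theorem proposition2p16:
  fixes Q2 F\<^sub>0 :: "'f::field_char_0 set"
    and \<sigma> :: "'f \<Rightarrow> 'f"
    and \<omega> :: "'f \<Rightarrow> ereal"
    and s :: "'f \<Rightarrow> 'v::ab_group_add \<Rightarrow> 'v"
    and h :: "'v \<Rightarrow> 'v \<Rightarrow> 'f"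
    and n m :: nat
    and L :: "'v set set"
    and c :: "'v set \<Rightarrow> real"
  assumes "ramified_dyadic_extension Q2 F\<^sub>0 \<sigma> \<omega>"
    and "split_hermitian_space s \<sigma> h n m"
    and "graded_lattice_chain \<omega> s UNIV (L, c)"
  shows "(\<exists>\<alpha> \<in> maxi_minorant_norms \<sigma> \<omega> s h. chain_of_norm \<omega> s UNIV \<alpha> (L, c)) \<longleftrightarrow>
    (\<exists>f Lpm cpm L0 c0.
       is_basis s {1..n} f UNIV \<and>
       induces_Witt_decomposition s h m f \<and>
       chain_direct_sum \<omega> s (V_pm s m f) (Lpm, cpm) (V_zero s m f) (L0, c0) (L, c) \<and>
       self_dual_chain \<omega> s h (V_pm s m f) (Lpm, cpm) \<and>
       adapted_basis \<omega> s (V_pm s m f) (Lpm, cpm) ({1..n} - {m + 1}) f \<and>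
       graded_lattice_chain \<omega> s (V_zero s m f) (L0, c0) \<and>
       (\<exists>\<alpha>\<^sub>0. norm_on \<omega> s (V_zero s m f) \<alpha>\<^sub>0 \<and>
             \<alpha>\<^sub>0 (f (m + 1)) = delta_inv \<sigma> \<omega> / 2 \<and>
             chain_of_norm \<omega> s (V_zero s m f) \<alpha>\<^sub>0 (L0, c0)))"
    (is "?L \<longleftrightarrow> ?R")
proof -
  interpret dyadic_split_space \<sigma> \<omega> s h n m
    unfolding dyadic_split_space_def
    using ramified_dyadic_extension.valued_involution[OF assms(1)] assms(2) by blast
  show ?thesis
  proof
    assume ?L
    then show ?R using decomposition_of_maxi_minorant by blast
  next
    assume ?R
    then obtain f Lpm cpm L0 c0 \<alpha>\<^sub>0 where f: "induces_Witt_decomposition s h m f"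
      "chain_direct_sum \<omega> s (V_pm s m f) (Lpm, cpm) (V_zero s m f) (L0, c0) (L, c)"
      "self_dual_chain \<omega> s h (V_pm s m f) (Lpm, cpm)"
      "adapted_basis \<omega> s (V_pm s m f) (Lpm, cpm) ({1..n} - {m + 1}) f"
      "\<alpha>\<^sub>0 (f (m + 1)) = delta_inv \<sigma> \<omega> / 2" "chain_of_norm \<omega> s (V_zero s m f) \<alpha>\<^sub>0 (L0, c0)"
      by blast
    have "antidiagonal_on h n f" using f(1) odd_dim unfolding induces_Witt_decomposition_def by simp
    from maxi_minorant_of_decomposition[OF this f(2-6)] show ?L .
  qed
qed

end
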